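(* I. Up to equivalence, all regular normal extensions for $\mathfrak{so}(3)/\mathfrak{so}(2)$ (the case $c=1$) to $\mathfrak{sl}(3,\mathbb{R})$ are given by the following one-parameter class with $t\geq 0$: $$\alpha(e,x_1,x_2)=\left(\begin{array}{ccc}\frac{t}{4}e & -\frac{3t^2+4}{4}x_1+\frac{t}{4}x_2 & -\frac{15t^2+16}{16}e \\ x_1 & -\frac{t}{2}e & -\frac{3t}{4}x_1-x_2 \\ e & tx_1+x_2 & \frac{t}{4}e\end{array}\right)$$ with curvature $$\kappa((e,x_1,x_2),(h,y_1,y_2))=\left(\begin{array}{ccc}0&\frac{3(t^3+t)}{2}(hx_1-ey_1)&0 \\ 0&0&-\frac{3t^2}{2}(hx_1-ey_1)-\frac{3t}{2}(hx_2-ey_2) \\ 0&0&0\end{array}\right).$$ II. Up to equivalence, all regular normal extensions for $\mathfrak{so}(2,1)/\mathfrak{so}(1,1)$ (the case $c=-1$) to $\mathfrak{sl}(3,\mathbb{R})$ are given by the following: a) for $b_1^2>b_2^2$, the one-parameter class, $t\ge0$, $$\alpha(e,x_1,x_2)=\left(\begin{array}{ccc}-\frac{t}{4}e & \frac{3t^2-4}{4}x_1-\frac{t}{4}x_2 & \frac{16-15t^2}{16}e \\ x_1 & \frac{t}{2}e & \frac{3t}{4}x_1+x_2 \\ e & tx_1+x_2 & -\frac{t}{4}e\end{array}\right)$$ with curvature $$\kappa((e,x_1,x_2),(h,y_1,y_2))=\left(\begin{array}{ccc}0&\frac{3(t^3-t)}{2}(hx_1-ey_1)&0 \\ 0&0&-\frac{3t^2}{2}(hx_1-ey_1)-\frac{3t}{2}(hx_2-ey_2)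 \\ 0&0&0\end{array}\right);$$ b) for $b_1^2=b_2^2$ and $b_3^2<b_4^2$, $$\alpha(e,x_1,x_2)=\left(\begin{array}{ccc}\frac14e&-x_1-\frac34x_2&\frac1{16}e \\ x_1+x_2&-\frac12e&\frac14x_1+\frac14x_2 \\ e&x_2&\frac14e\end{array}\right)$$ with curvature $$\kappa((e,x_1,x_2),(h,y_1,y_2))=\left(\begin{array}{ccc}0&\frac32(hx_1-ey_1)+\frac32(hx_2-ey_2)&0 \\ 0&0&0 \\ 0&0&0\end{array}\right);$$ c) for $b_1^2=b_2^2$ and $b_3^2=b_4^2$, $$\alpha(e,x_1,x_2)=\left(\begin{array}{ccc}\frac14e&-\frac18x_1+\frac18x_2&\frac1{32}e \\ x_1+x_2&-\frac12e&\frac18x_1+\frac18x_2 \\ 2e&-x_1+x_2&\frac14e\end{array}\right),$$ which is flat.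
   Context: For $c=\pm1$, $(e,x_1,x_2)$ denotes the element $\left(\begin{array}{ccc}0&e&-x_1 \\ -ce&0&-cx_2 \\ x_1&x_2&0\end{array}\right)$ of $\mathfrak g=\mathfrak{so}(2+c,1-c)$; $\mathfrak h$ is the line $x_1=x_2=0$ and $\mathfrak m$ is the plane $e=0$. $G/H$ is a symmetric space with these Lie algebras, $h\in H$ is the element acting as $-\mathrm{id}$ on $\mathfrak m$ (and trivially on $\mathfrak h$), and $K\cong\mathbb Z_2$ is the subgroup generated by the symmetry $h$. A Cartan geometry of type $(L,P)$ is a $P$-principal bundle with an $\mathfrak l$-valued 1-form $\omega$ which is $P$-equivariant, reproduces the generators of fundamental vector fields and is an isomorphism on each tangent space. Here $\mathfrak l=\mathfrak{sl}(3,\mathbb R)$ with contact grading by block diagonals: the $(i,j)$ entry has degree $j-i$; $\mathfrak p=\mathfrak l_0+\mathfrak l_1+\mathfrak l_2$ (upper triangular), and $P$ is the corresponding parabolic subgroup of a group $L$ with Lie algebra $\mathfrak l$. Extension: a homomorphism $i:K\to P$ and a linear map $\alpha:\mathfrak g\to\mathfrak l$ with $\alpha\circ\mathrm{Ad}(k)=\mathrm{Ad}(i(k))\circ\alpha$ for $k\in K$ and inducing an isomorphism $\mathfrak g/\mathfrak k\to\mathfrak l/\mathfrak p$ (here $\mathfrak k=0$). It gives the Cartan geometry $(G\times_iP\to G/K,\omega_\alpha)$ of type $(L,P)$, $\omega_\alpha$ extending $\alpha\circ\omega_G$ ($\omega_G$ the Maurer–Cartan form), with curvature $\kappa(X,Y)=[\alpha(X),\alpha(Y)]-\alpha([X,Y])$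 for $X,Y\in\mathfrak g$; flat means $\kappa=0$. Throughout $i$ is fixed, $i(h)=\mathrm{diag}(-1,1,-1)$. Regular: $\kappa$, viewed on $\mathfrak l/\mathfrak p$, satisfies $\kappa(\mathfrak l_i,\mathfrak l_j)\subset\bigoplus_{l\ge i+j+1}\mathfrak l_l$ for $i,j<0$. Normal: the standard (Kostant codifferential) normalization $\sum_i\kappa([Z_i,X],X_i)=2\sum_i[Z_i,\kappa(X,X_i)]$ for all $X\in\mathfrak l/\mathfrak p$, with $X_i$ a basis of $\mathfrak l/\mathfrak p$ and $Z_i$ the dual basis of $\mathfrak p_+=\mathfrak l_1+\mathfrak l_2$. Two extensions $\alpha,\alpha'$ are equivalent if there is a principal bundle morphism $\Phi$ of $G\times_iP$ with $\Phi^*\omega_{\alpha}=\omega_{\alpha'}$. Every regular extension has the form $$\alpha(e,x_1,x_2)=\left(\begin{array}{ccc}a_1e&d_1x_1+d_2x_2&c_1e \\ b_1x_1+b_2x_2&a_2e&d_3x_1+d_4x_2 \\ (b_1b_4-b_2b_3)e&b_3x_1+b_4x_2&-(a_1+a_2)e\end{array}\right)$$ with real coefficients and $b_1b_4-b_2b_3\ne0$. For $c=-1$ an equivalence can exchange $(b_1,b_3)$ with $(b_2,b_4)$; the case distinction a)–c) refers to representatives chosen so that $b_1^2\ge b_2^2$ and, if $b_1^2=b_2^2$, also $b_3^2\le b_4^2$.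
   Formalization: In II the classification is stated only for extensions whose own coefficients satisfy a), b) or c); those with b1²<b2², or b1²=b2² and b3²>b4², are left out: exchanging (b1,b3) with (b2,b4) is not an equivalence and none of them is equivalent to a listed extension. *)

theory Defs
  imports "HOL-Analysis.Analysis"
begin

type_synonym mat3 = "real^3^3"

definition bracket :: "mat3 \<Rightarrow> mat3 \<Rightarrow> mat3" where
  "bracket X Y = X ** Y - Y ** X"

definition Ad :: "mat3 \<Rightarrow> mat3 \<Rightarrow> mat3" where
  "Ad g X = g ** X ** matrix_inv g"


text \<open>
  The case \<open>c = 1\<close> is \<open>\<ss>\<oo>(3)\<close> and the case \<open>c = -1\<close> is \<open>\<ss>\<oo>(2,1)\<close>. The matrices
  \<open>so_elt c e x1 x2\<close> are exactly the \<open>X\<close> with \<open>X\<^sup>T J + J X = 0\<close>, where \<open>J = diag(1, c, 1)\<close>, and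
  \<open>G\<close> is the group \<open>SO(J)\<close>. For \<open>c = -1\<close> the full group with two components is needed: the symmetry
  \<open>h = diag(-1, -1, 1)\<close> does not lie in the identity component.
\<close>

definition so_elt :: "real \<Rightarrow> real \<Rightarrow> real \<Rightarrow> real \<Rightarrow> mat3" where
  "so_elt c e x1 x2 = vector
     [vector [0, e, - x1],
      vector [- c * e, 0, - c * x2],
      vector [x1, x2, 0]]"

definition so_alg :: "real \<Rightarrow> mat3 set" where
  "so_alg c = {so_elt c e x1 x2 | e x1 x2. True}"

definition form_matrix :: "real \<Rightarrow> mat3" where
  "form_matrix c = vector [vector [1, 0, 0], vector [0, c, 0], vector [0, 0, 1]]"

definition G_group :: "real \<Rightarrow> mat3 set" where
  "G_group c = {g. transpose g ** form_matrix c ** g = form_matrix c \<and> det g = 1}"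

definition h_sym :: mat3 where
  "h_sym = vector [vector [- 1, 0, 0], vector [0, - 1, 0], vector [0, 0, 1]]"

definition K_group :: "mat3 set" where
  "K_group = {mat 1, h_sym}"


text \<open>
  \<open>L = SL(3)\<close> over the reals. The grading and its filtration are written with the integer positions
  \<open>1, 2, 3\<close> of the indices, because \<open>3 = 0\<close> in the index type.
\<close>

definition pos :: "3 \<Rightarrow> int" where
  "pos i = (if i = 1 then 1 else if i = 2 then 2 else 3)"

definition sl3 :: "mat3 set" where
  "sl3 = {A. trace A = 0}"

definition sl3_grade :: "int \<Rightarrow> mat3 set" where
  "sl3_grade k = {A \<in> sl3. \<forall>i j. A $ i $ j \<noteq> 0 \<longrightarrow> pos j - pos i = k}"

definition sl3_filt :: "int \<Rightarrow> mat3 set" where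
  "sl3_filt k = {A \<in> sl3. \<forall>i j. A $ i $ j \<noteq> 0 \<longrightarrow> k \<le> pos j - pos i}"

abbreviation p_alg :: "mat3 set" where
  "p_alg \<equiv> sl3_filt 0"

definition P_group :: "mat3 set" where
  "P_group = {q. det q = 1 \<and> (\<forall>i j. pos j < pos i \<longrightarrow> q $ i $ j = 0)}"

definition iota :: "mat3 \<Rightarrow> mat3" where
  "iota k = (if k = h_sym
     then vector [vector [- 1, 0, 0], vector [0, 1, 0], vector [0, 0, - 1]] else mat 1)"


text \<open>
  Only the values of \<open>\<alpha>\<close> on \<open>so_alg c\<close> matter. The last condition says that \<open>\<alpha>\<close> induces a bijection
  \<open>\<gg> \<rightarrow> \<ll>/\<pp>\<close>.
\<close>

definition extension :: "real \<Rightarrow> (mat3 \<Rightarrow> mat3) \<Rightarrow> bool" where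
  "extension c \<alpha> \<longleftrightarrow>
     (\<forall>X\<in>so_alg c. \<alpha> X \<in> sl3) \<and>
     (\<forall>X\<in>so_alg c. \<forall>Y\<in>so_alg c. \<alpha> (X + Y) = \<alpha> X + \<alpha> Y) \<and>
     (\<forall>r. \<forall>X\<in>so_alg c. \<alpha> (r *\<^sub>R X) = r *\<^sub>R \<alpha> X) \<and>
     (\<forall>k\<in>K_group. \<forall>X\<in>so_alg c. \<alpha> (Ad k X) = Ad (iota k) (\<alpha> X)) \<and>
     (\<forall>U\<in>sl3. \<exists>!X. X \<in> so_alg c \<and> \<alpha> X - U \<in> p_alg)"

definition curvature :: "(mat3 \<Rightarrow> mat3) \<Rightarrow> mat3 \<Rightarrow> mat3 \<Rightarrow> mat3" where
  "curvature \<alpha> X Y = bracket (\<alpha> X) (\<alpha> Y) - \<alpha> (bracket X Y)"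

definition flat :: "real \<Rightarrow> (mat3 \<Rightarrow> mat3) \<Rightarrow> bool" where
  "flat c \<alpha> \<longleftrightarrow> (\<forall>X\<in>so_alg c. \<forall>Y\<in>so_alg c. curvature \<alpha> X Y = 0)"


text \<open>
  The curvature viewed on \<open>\<ll>/\<pp>\<close>; the arguments \<open>U\<close>, \<open>V\<close> are representatives in \<open>\<ll>\<close>.
\<close>

definition g_lift :: "real \<Rightarrow> (mat3 \<Rightarrow> mat3) \<Rightarrow> mat3 \<Rightarrow> mat3" where
  "g_lift c \<alpha> U = (THE X. X \<in> so_alg c \<and> \<alpha> X - U \<in> p_alg)"

definition curvature_lp :: "real \<Rightarrow> (mat3 \<Rightarrow> mat3) \<Rightarrow> mat3 \<Rightarrow> mat3 \<Rightarrow> mat3" where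
  "curvature_lp c \<alpha> U V = curvature \<alpha> (g_lift c \<alpha> U) (g_lift c \<alpha> V)"

definition regular :: "real \<Rightarrow> (mat3 \<Rightarrow> mat3) \<Rightarrow> bool" where
  "regular c \<alpha> \<longleftrightarrow>
     (\<forall>i<0. \<forall>j<0. \<forall>U\<in>sl3_grade i. \<forall>V\<in>sl3_grade j.
        curvature_lp c \<alpha> U V \<in> sl3_filt (i + j + 1))"


text \<open>
  \<open>elem_mat i j\<close> (\<open>j < i\<close>) represent a basis of \<open>\<ll>/\<pp>\<close>, and the \<open>elem_mat j i\<close> form the basis of
  \<open>\<pp>\<^sub>+\<close> dual to it under the trace form. The trace form is a multiple of the Killing form, so
  replacing one by the other rescales both sides of the normalization equally; the two sums do not
  depend on the choice of the basis.
\<close>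

definition elem_mat :: "3 \<Rightarrow> 3 \<Rightarrow> mat3" where
  "elem_mat i j = (\<chi> a b. if a = i \<and> b = j then 1 else 0)"

definition normal :: "real \<Rightarrow> (mat3 \<Rightarrow> mat3) \<Rightarrow> bool" where
  "normal c \<alpha> \<longleftrightarrow>
     (\<forall>U\<in>sl3.
        (\<Sum>(i, j)\<in>{(2, 1), (3, 2), (3, 1)}.
           curvature_lp c \<alpha> (bracket (elem_mat j i) U) (elem_mat i j)) =
        2 *\<^sub>R (\<Sum>(i, j)\<in>{(2, 1), (3, 2), (3, 1)}.
           bracket (elem_mat j i) (curvature_lp c \<alpha> U (elem_mat i j))))"

definition regular_normal_extension :: "real \<Rightarrow> (mat3 \<Rightarrow> mat3) \<Rightarrow> bool" where
  "regular_normal_extension c \<alpha> \<longleftrightarrow> extension c \<alpha> \<and> regular c \<alpha> \<and> normal c \<alpha>"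


text \<open>
  The bundle \<open>G \<times>\<^sub>i P\<close> is the quotient of \<open>G \<times> P\<close> by the free action \<open>(g, q) k = (g k, i(k)\<^sup>-\<^sup>1 q)\<close> of
  the finite group \<open>K\<close>; its points are the orbits.
\<close>

definition total_space :: "real \<Rightarrow> (mat3 \<times> mat3) set" where
  "total_space c = G_group c \<times> P_group"

definition orbit :: "mat3 \<times> mat3 \<Rightarrow> (mat3 \<times> mat3) set" where
  "orbit = (\<lambda>(g, q). {(g ** k, matrix_inv (iota k) ** q) | k. k \<in> K_group})"

definition assoc_bundle :: "real \<Rightarrow> (mat3 \<times> mat3) set set" where
  "assoc_bundle c = orbit ` total_space c"

definition right_act :: "(mat3 \<times> mat3) set \<Rightarrow> mat3 \<Rightarrow> (mat3 \<times> mat3) set" where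
  "right_act S q' = (\<lambda>(g, q). (g, q ** q')) ` S"

primrec Ck_on :: "nat \<Rightarrow> 'a::euclidean_space set \<Rightarrow> ('a \<Rightarrow> 'b::euclidean_space) \<Rightarrow> bool" where
  "Ck_on 0 S f \<longleftrightarrow> continuous_on S f"
| "Ck_on (Suc k) S f \<longleftrightarrow>
     (\<forall>x\<in>S. f differentiable (at x)) \<and> (\<forall>v. Ck_on k S (\<lambda>x. frechet_derivative f (at x) v))"

definition smooth_on :: "'a::euclidean_space set \<Rightarrow> ('a \<Rightarrow> 'b::euclidean_space) \<Rightarrow> bool" where
  "smooth_on S f \<longleftrightarrow> (\<forall>k. Ck_on k S f)"


text \<open>
  The projection \<open>G \<times> P \<rightarrow> G \<times>\<^sub>i P\<close> is a finite covering of manifolds, and \<open>G \<times> P\<close> is an embedded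
  submanifold of a vector space. So a map \<open>\<Phi>\<close> of \<open>G \<times>\<^sub>i P\<close> is smooth iff near each point of
  \<open>G \<times> P\<close> it is induced by a map \<open>F\<close> that is smooth on an open set of the ambient space.
\<close>

definition local_lift ::
  "real \<Rightarrow> ((mat3 \<times> mat3) set \<Rightarrow> (mat3 \<times> mat3) set) \<Rightarrow>
   (mat3 \<times> mat3) set \<Rightarrow> (mat3 \<times> mat3 \<Rightarrow> mat3 \<times> mat3) \<Rightarrow> bool" where
  "local_lift c \<Phi> W F \<longleftrightarrow>
     open W \<and> smooth_on W F \<and>
     (\<forall>u \<in> W \<inter> total_space c. F u \<in> total_space c \<and> orbit (F u) = \<Phi> (orbit u))"

definition principal_bundle_iso ::
  "real \<Rightarrow> ((mat3 \<times> mat3) set \<Rightarrow> (mat3 \<times> mat3) set) \<Rightarrow> bool" where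
  "principal_bundle_iso c \<Phi> \<longleftrightarrow>
     bij_betw \<Phi> (assoc_bundle c) (assoc_bundle c) \<and>
     (\<forall>S\<in>assoc_bundle c. \<forall>q\<in>P_group. \<Phi> (right_act S q) = right_act (\<Phi> S) q) \<and>
     (\<forall>u\<in>total_space c. \<exists>W F. u \<in> W \<and> local_lift c \<Phi> W F)"

definition tangent :: "real \<Rightarrow> mat3 \<times> mat3 \<Rightarrow> (mat3 \<times> mat3) set" where
  "tangent c = (\<lambda>(g, q). {(g ** X, q ** Y) | X Y. X \<in> so_alg c \<and> Y \<in> p_alg})"


text \<open>
  The pullback of \<open>\<omega>\<^sub>\<alpha>\<close> to \<open>G \<times> P\<close>. It is the \<open>P\<close>-equivariant form that reproduces the generators of
  fundamental vector fields and restricts to \<open>\<alpha> \<circ> \<omega>\<^sub>G\<close> along \<open>q = 1\<close>, where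
  \<open>\<omega>\<^sub>G = g\<^sup>-\<^sup>1 dg\<close>.
\<close>

definition omega :: "(mat3 \<Rightarrow> mat3) \<Rightarrow> mat3 \<times> mat3 \<Rightarrow> mat3 \<times> mat3 \<Rightarrow> mat3" where
  "omega \<alpha> = (\<lambda>(g, q) (U, V). Ad (matrix_inv q) (\<alpha> (matrix_inv g ** U)) + matrix_inv q ** V)"


text \<open>
  \<open>\<Phi>\<^sup>* \<omega>\<^sub>\<alpha> = \<omega>\<^sub>\<alpha>\<^sub>'\<close>, tested on a local lift of \<open>\<Phi>\<close> around each point. The value does not depend on
  the lift, because \<open>omega \<alpha>\<close> is invariant under the action of \<open>K\<close> and \<open>K\<close> is finite.
\<close>

definition pulls_back ::
  "real \<Rightarrow> ((mat3 \<times> mat3) set \<Rightarrow> (mat3 \<times> mat3) set) \<Rightarrow>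
   (mat3 \<Rightarrow> mat3) \<Rightarrow> (mat3 \<Rightarrow> mat3) \<Rightarrow> bool" where
  "pulls_back c \<Phi> \<alpha> \<alpha>' \<longleftrightarrow>
     (\<forall>u\<in>total_space c. \<exists>W F. u \<in> W \<and> local_lift c \<Phi> W F \<and>
        (\<forall>v\<in>tangent c u. omega \<alpha> (F u) (frechet_derivative F (at u) v) = omega \<alpha>' u v))"

definition equivalent_ext :: "real \<Rightarrow> (mat3 \<Rightarrow> mat3) \<Rightarrow> (mat3 \<Rightarrow> mat3) \<Rightarrow> bool" where
  "equivalent_ext c \<alpha> \<alpha>' \<longleftrightarrow> (\<exists>\<Phi>. principal_bundle_iso c \<Phi> \<and> pulls_back c \<Phi> \<alpha> \<alpha>')"


text \<open>
  \<open>in_coords f\<close> is the map \<open>(e, x1, x2) \<mapsto> f e x1 x2\<close> on \<open>so_alg c\<close>.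
\<close>

definition in_coords :: "(real \<Rightarrow> real \<Rightarrow> real \<Rightarrow> mat3) \<Rightarrow> mat3 \<Rightarrow> mat3" where
  "in_coords f X = f (X $ 1 $ 2) (X $ 3 $ 1) (X $ 3 $ 2)"

lemma in_coords_so_elt [simp]: "in_coords f (so_elt c e x1 x2) = f e x1 x2"
  by (simp add: in_coords_def so_elt_def)

definition alpha_I :: "real \<Rightarrow> mat3 \<Rightarrow> mat3" where
  "alpha_I t = in_coords (\<lambda>e x1 x2. vector
     [vector [t/4 * e, - ((3 * t^2 + 4)/4) * x1 + t/4 * x2, - ((15 * t^2 + 16)/16) * e],
      vector [x1, - (t/2) * e, - (3 * t/4) * x1 - x2],
      vector [e, t * x1 + x2, t/4 * e]])"

definition alpha_IIa :: "real \<Rightarrow> mat3 \<Rightarrow> mat3" where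
  "alpha_IIa t = in_coords (\<lambda>e x1 x2. vector
     [vector [- (t/4) * e, (3 * t^2 - 4)/4 * x1 - t/4 * x2, (16 - 15 * t^2)/16 * e],
      vector [x1, t/2 * e, 3 * t/4 * x1 + x2],
      vector [e, t * x1 + x2, - (t/4) * e]])"

definition alpha_IIb :: "mat3 \<Rightarrow> mat3" where
  "alpha_IIb = in_coords (\<lambda>e x1 x2. vector
     [vector [1/4 * e, - x1 - 3/4 * x2, 1/16 * e],
      vector [x1 + x2, - (1/2) * e, 1/4 * x1 + 1/4 * x2],
      vector [e, x2, 1/4 * e]])"

definition alpha_IIc :: "mat3 \<Rightarrow> mat3" where
  "alpha_IIc = in_coords (\<lambda>e x1 x2. vector
     [vector [1/4 * e, - (1/8) * x1 + 1/8 * x2, 1/32 * e],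
      vector [x1 + x2, - (1/2) * e, 1/8 * x1 + 1/8 * x2],
      vector [2 * e, - x1 + x2, 1/4 * e]])"


text \<open>
  \<open>b_coeffs c \<alpha> b1 b2 b3 b4\<close>: the entries of \<open>\<alpha>\<close> just below the diagonal are
  \<open>b1 x1 + b2 x2\<close> and \<open>b3 x1 + b4 x2\<close>.
\<close>

definition b_coeffs ::
  "real \<Rightarrow> (mat3 \<Rightarrow> mat3) \<Rightarrow> real \<Rightarrow> real \<Rightarrow> real \<Rightarrow> real \<Rightarrow> bool" where
  "b_coeffs c \<alpha> b1 b2 b3 b4 \<longleftrightarrow>
     (\<forall>e x1 x2. \<alpha> (so_elt c e x1 x2) $ 2 $ 1 = b1 * x1 + b2 * x2 \<and>
                \<alpha> (so_elt c e x1 x2) $ 3 $ 2 = b3 * x1 + b4 * x2)"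

end

theory Submission
  imports Defs
begin

text \<open>
  The degrees of the grading make the problem linear. Equivariance under the symmetry forces the entries
  of \<open>\<alpha>(e, x1, x2)\<close> in odd degree to depend on \<open>x1, x2\<close> only and those in even degree on \<open>e\<close> only.
  The entries \<open>y1 = b1 x1 + b2 x2\<close>, \<open>y2 = b3 x1 + b4 x2\<close> and \<open>z\<close> below the diagonal are linear
  coordinates on \<open>\<gg>\<close>, and regularity says that \<open>z = \<Delta> e\<close> with \<open>\<Delta> = b1 b4 - b2 b3\<close>. In the dual
  basis \<open>E, Y1, Y2\<close> of \<open>\<gg>\<close> the brackets are
  \<open>[Y1, Y2] = - E\<close>, \<open>[E, Y1] = p Y1 + q Y2\<close>, \<open>[E, Y2] = r Y1 - p Y2\<close>,
  so the extension enters the curvature only through \<open>p, q, r\<close> and its entries of degree 0, 1 and 2.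

  Relative to the degree of its arguments, the curvature has components of homogeneity 2, to which the
  entries of degree 0 and 1 contribute linearly, and 4, where the entry of degree 2 is linear. The
  normalization condition is therefore solved degree by degree, and it leaves exactly one free number
  \<open>A\<close> (lemmas \<open>normal_adapted_iff\<close> and \<open>normal_form_if_regular_normal_extension\<close>): with
  \<open>A' = - (A + p/2)\<close> the regular normal extensions are the maps
  with rows \<open>(A z, q y1 + A y2, (q r + A A') z)\<close>, \<open>(y1, p/2 z, A' y1 - r y2)\<close>, \<open>(z, y2, A' z)\<close>.
  Their curvature is \<open>3/2 p\<close> times a form that involves only \<open>q\<close> and \<open>r\<close> (\<open>curvature_normal_form\<close>),
  which gives the curvatures of all four families at once.

  Equivalences come from the bundle maps \<open>[g, w] \<mapsto> [g \<rho>, a w]\<close>, where \<open>\<rho>\<close> commutes with the symmetry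
  \<open>h\<close> and \<open>a \<in> P\<close> commutes with \<open>i(h)\<close> (\<open>equivalent_ext_by_symmetry\<close>). On the coefficients, \<open>\<rho>\<close> acts on
  the row vectors \<open>(b1, b2)\<close> and \<open>(b3, b4)\<close> simultaneously by an isometry of the form \<open>b1\<^sup>2 + c b2\<^sup>2\<close>, and
  the diagonal of \<open>a\<close> rescales the two rows independently. The corner entry of \<open>a\<close> translates \<open>A\<close>, so \<open>A\<close>
  carries no invariant and an extension is determined by its rows up to equivalence
  (\<open>equivalent_ext_normal_forms\<close>). What remains is the classification of two rows up to isometry and scaling.
  If the first row has positive norm, it becomes \<open>(1, 0)\<close> and the second \<open>(t, 1)\<close>, with \<open>t \<ge> 0\<close> after a
  reflection. For \<open>c = -1\<close> an isotropic first row becomes \<open>(1, 1)\<close>, while the second becomes \<open>(0, 1)\<close> if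
  \<open>b3\<^sup>2 < b4\<^sup>2\<close> and \<open>(-1, 1)\<close> if it is isotropic too.
\<close>

section \<open>Explicit three by three matrices\<close>

abbreviation (input) mat3_of :: "real \<Rightarrow> real \<Rightarrow> real \<Rightarrow> real \<Rightarrow> real \<Rightarrow> real \<Rightarrow> real \<Rightarrow> real \<Rightarrow> real \<Rightarrow> mat3" where
  "mat3_of a b c d e f g h i \<equiv> vector [vector [a, b, c], vector [d, e, f], vector [g, h, i]]"

lemma mat3_eq_iff:
  "(A :: mat3) = B \<longleftrightarrow>
     A $ 1 $ 1 = B $ 1 $ 1 \<and> A $ 1 $ 2 = B $ 1 $ 2 \<and> A $ 1 $ 3 = B $ 1 $ 3 \<and>
     A $ 2 $ 1 = B $ 2 $ 1 \<and> A $ 2 $ 2 = B $ 2 $ 2 \<and> A $ 2 $ 3 = B $ 2 $ 3 \<and>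
     A $ 3 $ 1 = B $ 3 $ 1 \<and> A $ 3 $ 2 = B $ 3 $ 2 \<and> A $ 3 $ 3 = B $ 3 $ 3"
  by (simp add: vec_eq_iff forall_3)

lemma mat3_of_eq_iff:
  "mat3_of a b c d e f g h i = mat3_of a' b' c' d' e' f' g' h' i' \<longleftrightarrow>
     a = a' \<and> b = b' \<and> c = c' \<and> d = d' \<and> e = e' \<and> f = f' \<and> g = g' \<and> h = h' \<and> i = i'"
  by (simp add: mat3_eq_iff)

lemma mat3_of_cases:
  fixes A :: mat3
  obtains a b c d e f g h i where "A = mat3_of a b c d e f g h i"
proof
  show "A = mat3_of (A$1$1) (A$1$2) (A$1$3) (A$2$1) (A$2$2) (A$2$3) (A$3$1) (A$3$2) (A$3$3)"
    by (simp add: mat3_eq_iff)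
qed

lemma mat3_of_arith:
  "mat3_of a b c d e f g h i + mat3_of a' b' c' d' e' f' g' h' i' =
     mat3_of (a + a') (b + b') (c + c') (d + d') (e + e') (f + f') (g + g') (h + h') (i + i')"
  "mat3_of a b c d e f g h i - mat3_of a' b' c' d' e' f' g' h' i' =
     mat3_of (a - a') (b - b') (c - c') (d - d') (e - e') (f - f') (g - g') (h - h') (i - i')"
  "k *\<^sub>R mat3_of a b c d e f g h i =
     mat3_of (k * a) (k * b) (k * c) (k * d) (k * e) (k * f) (k * g) (k * h) (k * i)"
  "mat3_of a b c d e f g h i ** mat3_of a' b' c' d' e' f' g' h' i' =
     mat3_of
       (a * a' + b * d' + c * g') (a * b' + b * e' + c * h') (a * c' + b * f' + c * i')
       (d * a' + e * d' + f * g') (d * b' + e * e' + f * h') (d * c' + e * f' + f * i')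
       (g * a' + h * d' + i * g') (g * b' + h * e' + i * h') (g * c' + h * f' + i * i')"
  "transpose (mat3_of a b c d e f g h i) = mat3_of a d g b e h c f i"
  "(0 :: mat3) = mat3_of 0 0 0 0 0 0 0 0 0"
  "(mat 1 :: mat3) = mat3_of 1 0 0 0 1 0 0 0 1"
  by (simp_all add: mat3_eq_iff matrix_matrix_mult_def sum_3 transpose_def mat_def)

lemma elem_mat_mat3_of:
  "elem_mat 2 1 = mat3_of 0 0 0 1 0 0 0 0 0" "elem_mat 3 2 = mat3_of 0 0 0 0 0 0 0 1 0"
  "elem_mat 3 1 = mat3_of 0 0 0 0 0 0 1 0 0" "elem_mat 1 2 = mat3_of 0 1 0 0 0 0 0 0 0"
  "elem_mat 2 3 = mat3_of 0 0 0 0 0 1 0 0 0" "elem_mat 1 3 = mat3_of 0 0 1 0 0 0 0 0 0"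
  by (simp_all add: elem_mat_def mat3_eq_iff)

lemma sl3_iff: "A \<in> sl3 \<longleftrightarrow> A $ 1 $ 1 + A $ 2 $ 2 + A $ 3 $ 3 = 0"
  by (simp add: sl3_def trace_def sum_3)

lemma p_alg_iff: "A \<in> p_alg \<longleftrightarrow> A \<in> sl3 \<and> A $ 2 $ 1 = 0 \<and> A $ 3 $ 2 = 0 \<and> A $ 3 $ 1 = 0"
  by (auto simp: sl3_filt_def pos_def forall_3)

lemma normal_sum: "(\<Sum>(i, j)\<in>{(2, 1), (3, 2), (3, 1)}. f (i :: 3) (j :: 3)) = f 2 1 + f 3 2 + (f 3 1 :: mat3)"
  by (simp add: add.assoc)

text \<open>
  The value of \<open>matrix_inv\<close> is a choice among two-sided inverses. Having a one-sided inverse at hand is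
  enough to compute it, which turns every \<open>Ad\<close> below into an explicit product.
\<close>

lemma matrix_inv_unique:
  fixes A B :: "real^'n^'n"
  assumes "A ** B = mat 1"
  shows "matrix_inv A = B"
proof -
  have BA: "B ** A = mat 1"
    using assms matrix_left_right_inverse by blast
  have "A ** matrix_inv A = mat 1 \<and> matrix_inv A ** A = mat 1"
    unfolding matrix_inv_def by (rule someI[where x = B]) (use assms BA in blast)
  then show ?thesis
    by (metis BA matrix_mul_assoc matrix_mul_lid matrix_mul_rid)
qed

lemma Ad_eq:
  assumes "g ** g' = mat 1"
  shows "Ad g X = g ** X ** g'"
  by (simp add: Ad_def matrix_inv_unique[OF assms])


section \<open>The symmetric space and frames adapted to an extension\<close>

lemma h_sym_mat3_of: "h_sym = mat3_of (- 1) 0 0 0 (- 1) 0 0 0 1"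
  by (simp add: h_sym_def)

lemma iota_h_sym: "iota h_sym = mat3_of (- 1) 0 0 0 1 0 0 0 (- 1)"
  by (simp add: iota_def)

lemma iota_one: "iota (mat 1) = mat 1"
  by (simp add: iota_def h_sym_mat3_of mat3_of_arith mat3_of_eq_iff)

lemma h_sym_involution: "h_sym ** h_sym = mat 1" "iota h_sym ** iota h_sym = mat 1"
  unfolding iota_h_sym by (simp_all add: h_sym_mat3_of mat3_of_arith)

lemma Ad_one: "Ad (mat 1) X = X"
  by (simp add: Ad_eq[of "mat 1" "mat 1"])

lemma Ad_h_sym: "Ad h_sym (so_elt c e x1 x2) = so_elt c e (- x1) (- x2)"
  unfolding Ad_eq[OF h_sym_involution(1)]
  by (simp add: h_sym_mat3_of so_elt_def mat3_of_arith mat3_of_eq_iff)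

lemma Ad_iota_h_sym:
  "Ad (iota h_sym) (mat3_of a b c d e f g h i) = mat3_of a (- b) c (- d) e (- f) g (- h) i"
  unfolding Ad_eq[OF h_sym_involution(2)]
  by (simp add: iota_h_sym mat3_of_arith mat3_of_eq_iff)

lemma so_elt_in_so_alg [simp]: "so_elt c e x1 x2 \<in> so_alg c"
  by (auto simp: so_alg_def)

lemma so_elt_add: "so_elt c e x1 x2 + so_elt c h y1 y2 = so_elt c (e + h) (x1 + y1) (x2 + y2)"
  by (simp add: so_elt_def mat3_of_arith mat3_of_eq_iff algebra_simps)

lemma so_elt_scaleR: "k *\<^sub>R so_elt c e x1 x2 = so_elt c (k * e) (k * x1) (k * x2)"
  by (simp add: so_elt_def mat3_of_arith mat3_of_eq_iff algebra_simps)

lemma so_elt_eq_iff: "so_elt c e x1 x2 = so_elt c h y1 y2 \<longleftrightarrow> e = h \<and> x1 = y1 \<and> x2 = y2"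
  by (auto simp: so_elt_def mat3_of_eq_iff)

lemma bracket_so_elt:
  "bracket (so_elt c e x1 x2) (so_elt c h y1 y2) =
     so_elt c (x2 * y1 - x1 * y2) (c * (e * y2 - h * x2)) (h * x1 - e * y1)"
  by (simp add: bracket_def so_elt_def mat3_of_arith mat3_of_eq_iff algebra_simps)

text \<open>
  The element of \<open>\<gg>\<close> with adapted coordinates \<open>(z, y1, y2)\<close>. It inverts the substitution
  \<open>z = \<Delta> e\<close>, \<open>y1 = b1 x1 + b2 x2\<close>, \<open>y2 = b3 x1 + b4 x2\<close>.
\<close>

definition frame ::
  "real \<Rightarrow> real \<Rightarrow> real \<Rightarrow> real \<Rightarrow> real \<Rightarrow> real \<Rightarrow> real \<Rightarrow> real \<Rightarrow> mat3" where
  "frame c b1 b2 b3 b4 z y1 y2 =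
     (let \<Delta> = b1 * b4 - b2 * b3
      in so_elt c (z / \<Delta>) ((b4 * y1 - b2 * y2) / \<Delta>) ((b1 * y2 - b3 * y1) / \<Delta>))"

text \<open>
  The structure constants of \<open>\<gg>\<close> in the basis \<open>E, Y1, Y2\<close> dual to the adapted coordinates:
  \<open>[E, Y1] = p Y1 + q Y2\<close> and \<open>[E, Y2] = r Y1 - p Y2\<close>. Up to sign and the factor \<open>1/\<Delta>\<^sup>2\<close> they are the entries
  of the Gram matrix of the rows \<open>(b1, b2)\<close> and \<open>(b3, b4)\<close> for the form \<open>diag(c, 1)\<close>; for \<open>c = \<plusminus>1\<close>
  this is \<open>c\<close> times the form \<open>diag(1, c)\<close>.
\<close>

definition str_p :: "real \<Rightarrow> real \<Rightarrow> real \<Rightarrow> real \<Rightarrow> real \<Rightarrow> real" where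
  "str_p c b1 b2 b3 b4 = - (c * b1 * b3 + b2 * b4) / (b1 * b4 - b2 * b3)^2"

definition str_q :: "real \<Rightarrow> real \<Rightarrow> real \<Rightarrow> real \<Rightarrow> real \<Rightarrow> real" where
  "str_q c b1 b2 b3 b4 = - (c * b3^2 + b4^2) / (b1 * b4 - b2 * b3)^2"

definition str_r :: "real \<Rightarrow> real \<Rightarrow> real \<Rightarrow> real \<Rightarrow> real \<Rightarrow> real" where
  "str_r c b1 b2 b3 b4 = (c * b1^2 + b2^2) / (b1 * b4 - b2 * b3)^2"

lemma so_elt_eq_frame:
  assumes "b1 * b4 - b2 * b3 \<noteq> 0"
  shows "so_elt c e x1 x2 =
    frame c b1 b2 b3 b4 ((b1 * b4 - b2 * b3) * e) (b1 * x1 + b2 * x2) (b3 * x1 + b4 * x2)"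
proof -
  have "b4 * (b1 * x1 + b2 * x2) - b2 * (b3 * x1 + b4 * x2) = (b1 * b4 - b2 * b3) * x1"
    "b1 * (b3 * x1 + b4 * x2) - b3 * (b1 * x1 + b2 * x2) = (b1 * b4 - b2 * b3) * x2"
    by algebra+
  then show ?thesis
    using assms by (simp add: frame_def Let_def)
qed

lemma frame_coords:
  fixes b1 b2 b3 b4 y1 y2 z :: real
  assumes "\<Delta> = b1 * b4 - b2 * b3" "\<Delta> \<noteq> 0"
  shows "b1 * ((b4 * y1 - b2 * y2) / \<Delta>) + b2 * ((b1 * y2 - b3 * y1) / \<Delta>) = y1"
    "b3 * ((b4 * y1 - b2 * y2) / \<Delta>) + b4 * ((b1 * y2 - b3 * y1) / \<Delta>) = y2"
    "\<Delta> * (z / \<Delta>) = z"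
  using assms(2) by (simp_all add: divide_simps) (simp_all add: assms(1) algebra_simps)

lemma bracket_frame:
  fixes c b1 b2 b3 b4 z y1 y2 w v1 v2 :: real
  assumes "b1 * b4 - b2 * b3 \<noteq> 0"
  defines "p \<equiv> str_p c b1 b2 b3 b4" and "q \<equiv> str_q c b1 b2 b3 b4" and "r \<equiv> str_r c b1 b2 b3 b4"
  shows "bracket (frame c b1 b2 b3 b4 z y1 y2) (frame c b1 b2 b3 b4 w v1 v2) =
    frame c b1 b2 b3 b4 (y2 * v1 - y1 * v2)
      (p * (z * v1 - w * y1) + r * (z * v2 - w * y2))
      (q * (z * v1 - w * y1) - p * (z * v2 - w * y2))"
proof -
  define \<Delta> where "\<Delta> = b1 * b4 - b2 * b3"
  have \<Delta>: "\<Delta> \<noteq> 0"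
    using assms by (simp add: \<Delta>_def)
  have str: "p = - (c * b1 * b3 + b2 * b4) / \<Delta>^2" "q = - (c * b3^2 + b4^2) / \<Delta>^2"
    "r = (c * b1^2 + b2^2) / \<Delta>^2"
    by (simp_all add: p_def q_def r_def str_p_def str_q_def str_r_def \<Delta>_def)
  \<comment> \<open>The identities hold after clearing powers of \<open>\<Delta>\<close>; \<open>s\<close> and \<open>t\<close> stand for \<open>z v1 - w y1\<close> and \<open>z v2 - w y2\<close>.\<close>
  have 1: "(b1 * y2 - b3 * y1) * (b4 * v1 - b2 * v2) - (b4 * y1 - b2 * y2) * (b1 * v2 - b3 * v1)
      = \<Delta> * (y2 * v1 - y1 * v2)"
    unfolding \<Delta>_def by algebra
  have 2: "\<Delta>^2 * (b4 * (p * s + r * t) - b2 * (q * s - p * t)) = \<Delta> * (c * (b1 * t - b3 * s))"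
    "\<Delta>^2 * (b1 * (q * s - p * t) - b3 * (p * s + r * t)) = \<Delta> * (b2 * t - b4 * s)" for s t
  proof -
    have "\<Delta>^2 * p = - (c * b1 * b3 + b2 * b4)" "\<Delta>^2 * q = - (c * b3^2 + b4^2)"
      "\<Delta>^2 * r = c * b1^2 + b2^2"
      using \<Delta> by (simp_all add: str)
    then show "\<Delta>^2 * (b4 * (p * s + r * t) - b2 * (q * s - p * t)) = \<Delta> * (c * (b1 * t - b3 * s))"
      "\<Delta>^2 * (b1 * (q * s - p * t) - b3 * (p * s + r * t)) = \<Delta> * (b2 * t - b4 * s)"
      unfolding \<Delta>_def by algebra+
  qed
  have 3: "(b4 * (p * s + r * t) - b2 * (q * s - p * t)) / \<Delta> = c * (b1 * t - b3 * s) / \<Delta>^2"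
    "(b1 * (q * s - p * t) - b3 * (p * s + r * t)) / \<Delta> = (b2 * t - b4 * s) / \<Delta>^2" for s t
    using \<Delta> 2[of s t] by (simp_all add: field_simps power2_eq_square)
  show ?thesis
    unfolding frame_def Let_def bracket_so_elt so_elt_eq_iff \<Delta>_def[symmetric] 3
  proof (intro conjI)
    show "(b1 * y2 - b3 * y1) / \<Delta> * ((b4 * v1 - b2 * v2) / \<Delta>) -
      (b4 * y1 - b2 * y2) / \<Delta> * ((b1 * v2 - b3 * v1) / \<Delta>) = (y2 * v1 - y1 * v2) / \<Delta>"
      using 1 \<Delta> by (simp add: divide_simps)
    show "c * (z / \<Delta> * ((b1 * v2 - b3 * v1) / \<Delta>) - w / \<Delta> * ((b1 * y2 - b3 * y1) / \<Delta>)) =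
      c * (b1 * (z * v2 - w * y2) - b3 * (z * v1 - w * y1)) / \<Delta>^2"
      using \<Delta> by (simp add: divide_simps) algebra
    show "w / \<Delta> * ((b4 * y1 - b2 * y2) / \<Delta>) - z / \<Delta> * ((b4 * v1 - b2 * v2) / \<Delta>) =
      (b2 * (z * v2 - w * y2) - b4 * (z * v1 - w * y1)) / \<Delta>^2"
      using \<Delta> by (simp add: divide_simps) algebra
  qed
qed

text \<open>
  The shape that equivariance and regularity leave, in adapted coordinates: the entry in position
  \<open>(i, j)\<close> depends on \<open>z\<close> if \<open>j - i\<close> is even and on \<open>y1, y2\<close> if it is odd, and the entries below the
  diagonal are the coordinates themselves.
\<close>

definition cartan_form ::
  "real \<Rightarrow> real \<Rightarrow> real \<Rightarrow> real \<Rightarrow> real \<Rightarrow> real \<Rightarrow> real \<Rightarrow> real \<Rightarrow> real \<Rightarrow> real \<Rightarrow> mat3" where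
  "cartan_form A1 A2 C D1 D2 D3 D4 z y1 y2 = vector
     [vector [A1 * z, D1 * y1 + D2 * y2, C * z],
      vector [y1, A2 * z, D3 * y1 + D4 * y2],
      vector [z, y2, - (A1 + A2) * z]]"

definition adapted ::
  "real \<Rightarrow> (mat3 \<Rightarrow> mat3) \<Rightarrow> real \<Rightarrow> real \<Rightarrow> real \<Rightarrow> real \<Rightarrow>
   real \<Rightarrow> real \<Rightarrow> real \<Rightarrow> real \<Rightarrow> real \<Rightarrow> real \<Rightarrow> real \<Rightarrow> bool" where
  "adapted c \<alpha> b1 b2 b3 b4 A1 A2 C D1 D2 D3 D4 \<longleftrightarrow>
     b1 * b4 - b2 * b3 \<noteq> 0 \<and>
     (\<forall>z y1 y2. \<alpha> (frame c b1 b2 b3 b4 z y1 y2) = cartan_form A1 A2 C D1 D2 D3 D4 z y1 y2)"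

lemma adapted_so_elt_iff:
  "adapted c \<alpha> b1 b2 b3 b4 A1 A2 C D1 D2 D3 D4 \<longleftrightarrow>
     b1 * b4 - b2 * b3 \<noteq> 0 \<and>
     (\<forall>e x1 x2. \<alpha> (so_elt c e x1 x2) = cartan_form A1 A2 C D1 D2 D3 D4
        ((b1 * b4 - b2 * b3) * e) (b1 * x1 + b2 * x2) (b3 * x1 + b4 * x2))" (is "_ = ?R")
proof
  show ?R if "adapted c \<alpha> b1 b2 b3 b4 A1 A2 C D1 D2 D3 D4"
    using that so_elt_eq_frame[of b1 b4 b2 b3 c] by (simp add: adapted_def)
  show "adapted c \<alpha> b1 b2 b3 b4 A1 A2 C D1 D2 D3 D4" if ?R
    using that by (simp add: adapted_def frame_def Let_def frame_coords[OF refl]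
        del: times_divide_eq_right times_divide_eq_left)
qed

lemma frame_eq_iff:
  assumes "b1 * b4 - b2 * b3 \<noteq> 0"
  shows "frame c b1 b2 b3 b4 z y1 y2 = frame c b1 b2 b3 b4 w v1 v2 \<longleftrightarrow> z = w \<and> y1 = v1 \<and> y2 = v2"
  unfolding frame_def Let_def so_elt_eq_iff
  by (metis frame_coords[OF refl assms] assms nonzero_mult_div_cancel_left times_divide_eq_right)

lemma so_alg_frame:
  assumes "b1 * b4 - b2 * b3 \<noteq> 0"
  shows "X \<in> so_alg c \<longleftrightarrow> (\<exists>z y1 y2. X = frame c b1 b2 b3 b4 z y1 y2)"
proof
  show "\<exists>z y1 y2. X = frame c b1 b2 b3 b4 z y1 y2" if "X \<in> so_alg c"
    using that so_elt_eq_frame[OF assms] unfolding so_alg_def by blast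
  show "X \<in> so_alg c" if "\<exists>z y1 y2. X = frame c b1 b2 b3 b4 z y1 y2"
    using that by (auto simp: frame_def Let_def)
qed

lemma frame_arith:
  "frame c b1 b2 b3 b4 z y1 y2 + frame c b1 b2 b3 b4 w v1 v2 = frame c b1 b2 b3 b4 (z + w) (y1 + v1) (y2 + v2)"
  "k *\<^sub>R frame c b1 b2 b3 b4 z y1 y2 = frame c b1 b2 b3 b4 (k * z) (k * y1) (k * y2)"
  "Ad h_sym (frame c b1 b2 b3 b4 z y1 y2) = frame c b1 b2 b3 b4 z (- y1) (- y2)"
  by (simp_all add: frame_def Let_def so_elt_add so_elt_scaleR Ad_h_sym so_elt_eq_iff add_divide_distrib
      diff_divide_distrib algebra_simps)


section \<open>Curvature and normalization in an adapted frame\<close>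

lemma curvature_adapted:
  fixes c b1 b2 b3 b4 A1 A2 C D1 D2 D3 D4 z y1 y2 w v1 v2 :: real
  assumes "adapted c \<alpha> b1 b2 b3 b4 A1 A2 C D1 D2 D3 D4"
  defines "p \<equiv> str_p c b1 b2 b3 b4" and "q \<equiv> str_q c b1 b2 b3 b4" and "r \<equiv> str_r c b1 b2 b3 b4"
    and "A3 \<equiv> - (A1 + A2)"
  shows "curvature \<alpha> (frame c b1 b2 b3 b4 z y1 y2) (frame c b1 b2 b3 b4 w v1 v2) =
    (let \<theta> = y1 * v2 - y2 * v1; \<phi> = y1 * w - z * v1; \<psi> = y2 * w - z * v2
     in vector
      [vector [(A1 - D2) * \<theta>,
               (D1 * (A2 - A1) + p * D1 + q * D2) * \<phi> + (D2 * (A2 - A1) + r * D1 - p * D2 - C) * \<psi>,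
               (C + D1 * D4 - D2 * D3) * \<theta>],
       vector [(A1 - A2 + D3 + p) * \<phi> + (D4 + r) * \<psi>,
               (A2 + D2 + D3) * \<theta>,
               (C + D3 * (A3 - A2) + p * D3 + q * D4) * \<phi> + (D4 * (A3 - A2) + r * D3 - p * D4) * \<psi>],
       vector [0,
               (q - D1) * \<phi> + (A2 - A3 - D2 - p) * \<psi>,
               (A3 - D3) * \<theta>]])"
proof -
  have nz: "b1 * b4 - b2 * b3 \<noteq> 0"
    and \<alpha>: "\<alpha> (frame c b1 b2 b3 b4 z y1 y2) = cartan_form A1 A2 C D1 D2 D3 D4 z y1 y2" for z y1 y2
    using assms(1) by (simp_all add: adapted_def)
  show ?thesis
    unfolding curvature_def bracket_frame[OF nz] \<alpha> p_def[symmetric] q_def[symmetric] r_def[symmetric]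
    by (simp add: bracket_def cartan_form_def Let_def mat3_of_arith mat3_of_eq_iff A3_def algebra_simps)
qed

lemma adapted_solvable:
  assumes "adapted c \<alpha> b1 b2 b3 b4 A1 A2 C D1 D2 D3 D4" "U \<in> sl3"
  shows "X \<in> so_alg c \<and> \<alpha> X - U \<in> p_alg \<longleftrightarrow> X = frame c b1 b2 b3 b4 (U $ 3 $ 1) (U $ 2 $ 1) (U $ 3 $ 2)"
proof -
  have nz: "b1 * b4 - b2 * b3 \<noteq> 0"
    and \<alpha>: "\<alpha> (frame c b1 b2 b3 b4 z y1 y2) = cartan_form A1 A2 C D1 D2 D3 D4 z y1 y2" for z y1 y2
    using assms(1) by (simp_all add: adapted_def)
  have *: "\<alpha> (frame c b1 b2 b3 b4 z y1 y2) - U \<in> p_alg \<longleftrightarrow> z = U $ 3 $ 1 \<and> y1 = U $ 2 $ 1 \<and> y2 = U $ 3 $ 2" for z y1 y2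
    using assms(2) by (auto simp: \<alpha> p_alg_iff sl3_iff cartan_form_def algebra_simps)
  show ?thesis
    unfolding so_alg_frame[OF nz] using * by (metis frame_eq_iff[OF nz])
qed

lemma g_lift_adapted:
  assumes "adapted c \<alpha> b1 b2 b3 b4 A1 A2 C D1 D2 D3 D4" "U \<in> sl3"
  shows "g_lift c \<alpha> U = frame c b1 b2 b3 b4 (U $ 3 $ 1) (U $ 2 $ 1) (U $ 3 $ 2)"
  unfolding g_lift_def adapted_solvable[OF assms] by simp

lemma extension_adapted:
  assumes "adapted c \<alpha> b1 b2 b3 b4 A1 A2 C D1 D2 D3 D4"
  shows "extension c \<alpha>"
proof -
  have nz: "b1 * b4 - b2 * b3 \<noteq> 0"
    and \<alpha>: "\<alpha> (frame c b1 b2 b3 b4 z y1 y2) = cartan_form A1 A2 C D1 D2 D3 D4 z y1 y2" for z y1 y2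
    using assms(1) by (simp_all add: adapted_def)
  show ?thesis
    unfolding extension_def
  proof (intro conjI ballI allI)
    fix X assume "X \<in> so_alg c"
    then obtain z y1 y2 where X: "X = frame c b1 b2 b3 b4 z y1 y2"
      using so_alg_frame[OF nz] by blast
    show "\<alpha> X \<in> sl3"
      by (simp add: X \<alpha> cartan_form_def sl3_iff algebra_simps)
    show "\<alpha> (k *\<^sub>R X) = k *\<^sub>R \<alpha> X" for k
      by (simp add: X frame_arith \<alpha> cartan_form_def mat3_of_arith mat3_of_eq_iff algebra_simps)
    show "\<alpha> (Ad k X) = Ad (iota k) (\<alpha> X)" if "k \<in> K_group" for k
    proof (cases "k = h_sym")
      case True
      then show ?thesis
        by (simp add: X frame_arith \<alpha> cartan_form_def Ad_iota_h_sym mat3_of_eq_iff algebra_simps)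
    next
      case False
      then show ?thesis
        using that by (simp add: K_group_def iota_one Ad_one)
    qed
    fix Y assume "Y \<in> so_alg c"
    then obtain w v1 v2 where Y: "Y = frame c b1 b2 b3 b4 w v1 v2"
      using so_alg_frame[OF nz] by blast
    show "\<alpha> (X + Y) = \<alpha> X + \<alpha> Y"
      by (simp add: X Y frame_arith \<alpha> cartan_form_def mat3_of_arith mat3_of_eq_iff algebra_simps)
  next
    fix U assume "U \<in> sl3"
    then show "\<exists>!X. X \<in> so_alg c \<and> \<alpha> X - U \<in> p_alg"
      unfolding adapted_solvable[OF assms \<open>U \<in> sl3\<close>] by simp
  qed
qed

text \<open>
  The grade \<open>-2\<close> imposes nothing, since the filtration then exhausts \<open>\<ll>\<close>. For two arguments of grade
  \<open>-1\<close> the lower left entry of the curvature must vanish, and it does because the bracket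
  \<open>[Y1, Y2] = - E\<close> matches the bracket of the corresponding elementary matrices.
\<close>

lemma regular_adapted:
  assumes "adapted c \<alpha> b1 b2 b3 b4 A1 A2 C D1 D2 D3 D4"
  shows "regular c \<alpha>"
  unfolding regular_def
proof (intro allI impI ballI)
  fix i j :: int and U V
  assume ij: "i < 0" "j < 0" and UV: "U \<in> sl3_grade i" "V \<in> sl3_grade j"
  then have sl: "U \<in> sl3" "V \<in> sl3"
    by (auto simp: sl3_grade_def)
  have grade: "U $ 3 $ 1 = 0" "V $ 3 $ 1 = 0" if "\<not> i + j + 1 \<le> -2"
  proof -
    have "U $ 3 $ 1 \<noteq> 0 \<longrightarrow> pos 1 - pos 3 = i" "V $ 3 $ 1 \<noteq> 0 \<longrightarrow> pos 1 - pos 3 = j"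
      using UV unfolding sl3_grade_def by blast+
    then show "U $ 3 $ 1 = 0" "V $ 3 $ 1 = 0"
      using ij that by (auto simp: pos_def)
  qed
  show "curvature_lp c \<alpha> U V \<in> sl3_filt (i + j + 1)"
    unfolding curvature_lp_def g_lift_adapted[OF assms sl(1)] g_lift_adapted[OF assms sl(2)]
      curvature_adapted[OF assms]
    using grade ij by (auto simp: sl3_filt_def pos_def forall_3 sl3_iff Let_def algebra_simps)
qed

lemma bracket_in_sl3 [simp]: "bracket X Y \<in> sl3"
  by (simp add: bracket_def sl3_def trace_sub trace_mul_sym[of X Y])

text \<open>
  Let \<open>K12\<close>, \<open>K1e\<close>, \<open>K2e\<close> be the values of the curvature on pairs of basis vectors. The sums over the dual
  bases collapse, because bracketing with \<open>\<pp>\<^sub>+\<close> raises the degree: normality amounts to the three matrix equations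
  \<open>[e23, K12] + [e13, K1e] = 0\<close>, \<open>[e13, K2e] - [e12, K12] = 0\<close>, \<open>K12 + [e12, K1e] + [e23, K2e] = 0\<close>.
  Their entries on and next to the diagonal are linear equations for the coefficients of homogeneity 2 and have a
  one-parameter solution; the corner entry of the last one then gives \<open>C\<close>.
\<close>

lemma normal_adapted_iff:
  fixes c b1 b2 b3 b4 A1 A2 C D1 D2 D3 D4 :: real
  assumes "adapted c \<alpha> b1 b2 b3 b4 A1 A2 C D1 D2 D3 D4"
  defines "p \<equiv> str_p c b1 b2 b3 b4" and "q \<equiv> str_q c b1 b2 b3 b4" and "r \<equiv> str_r c b1 b2 b3 b4"
  shows "normal c \<alpha> \<longleftrightarrow>
    A2 = p / 2 \<and> C = q * r - A1 * (A1 + p / 2) \<and>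
    D1 = q \<and> D2 = A1 \<and> D3 = - (A1 + p / 2) \<and> D4 = - r" (is "_ \<longleftrightarrow> ?R")
proof -
  define K where "K U V = curvature_lp c \<alpha> U V" for U V
  note K = K_def curvature_lp_def g_lift_adapted[OF assms(1)] curvature_adapted[OF assms(1)]
    p_def[symmetric] q_def[symmetric] r_def[symmetric]
  note calc = elem_mat_mat3_of bracket_def mat3_of_arith mat3_of_eq_iff Let_def
  have sl: "elem_mat 2 1 \<in> sl3" "elem_mat 3 2 \<in> sl3" "elem_mat 3 1 \<in> sl3"
    by (simp_all add: sl3_iff elem_mat_mat3_of)
  define K12 where "K12 = K (elem_mat 2 1) (elem_mat 3 2)"
  define K1e where "K1e = K (elem_mat 2 1) (elem_mat 3 1)"
  define K2e where "K2e = K (elem_mat 3 2) (elem_mat 3 1)"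
  have K_expand: "K U V = (U$2$1 * V$3$2 - U$3$2 * V$2$1) *\<^sub>R K12
      + (U$2$1 * V$3$1 - U$3$1 * V$2$1) *\<^sub>R K1e + (U$3$2 * V$3$1 - U$3$1 * V$3$2) *\<^sub>R K2e"
    if "U \<in> sl3" "V \<in> sl3" for U V
    unfolding K12_def K1e_def K2e_def
    by (simp add: K sl that, simp add: calc algebra_simps)
  have normal_K: "normal c \<alpha> \<longleftrightarrow> (\<forall>U\<in>sl3.
      (U$3$1) *\<^sub>R K12 =
      (U$2$1) *\<^sub>R (bracket (elem_mat 2 3) K12 + bracket (elem_mat 1 3) K1e)
      + (U$3$2) *\<^sub>R (bracket (elem_mat 1 3) K2e - bracket (elem_mat 1 2) K12)
      - (U$3$1) *\<^sub>R (bracket (elem_mat 1 2) K1e + bracket (elem_mat 2 3) K2e))"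
    unfolding normal_def normal_sum K_def[symmetric]
  proof (rule ball_cong[OF refl])
    fix U assume U: "U \<in> sl3"
    obtain a1 a2 a3 a4 a5 a6 a7 a8 a9 where U': "U = mat3_of a1 a2 a3 a4 a5 a6 a7 a8 a9"
      by (rule mat3_of_cases)
    obtain k1 k2 k3 k4 k5 k6 k7 k8 k9 where 1: "K12 = mat3_of k1 k2 k3 k4 k5 k6 k7 k8 k9"
      by (rule mat3_of_cases)
    obtain l1 l2 l3 l4 l5 l6 l7 l8 l9 where 2: "K1e = mat3_of l1 l2 l3 l4 l5 l6 l7 l8 l9"
      by (rule mat3_of_cases)
    obtain m1 m2 m3 m4 m5 m6 m7 m8 m9 where 3: "K2e = mat3_of m1 m2 m3 m4 m5 m6 m7 m8 m9"
      by (rule mat3_of_cases)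
    show "(K (bracket (elem_mat 1 2) U) (elem_mat 2 1) + K (bracket (elem_mat 2 3) U) (elem_mat 3 2)
        + K (bracket (elem_mat 1 3) U) (elem_mat 3 1) =
        2 *\<^sub>R (bracket (elem_mat 1 2) (K U (elem_mat 2 1)) + bracket (elem_mat 2 3) (K U (elem_mat 3 2))
          + bracket (elem_mat 1 3) (K U (elem_mat 3 1)))) \<longleftrightarrow>
      (U$3$1) *\<^sub>R K12 =
      (U$2$1) *\<^sub>R (bracket (elem_mat 2 3) K12 + bracket (elem_mat 1 3) K1e)
      + (U$3$2) *\<^sub>R (bracket (elem_mat 1 3) K2e - bracket (elem_mat 1 2) K12)
      - (U$3$1) *\<^sub>R (bracket (elem_mat 1 2) K1e + bracket (elem_mat 2 3) K2e)"
      unfolding K_expand[OF U sl(1)] K_expand[OF U sl(2)] K_expand[OF U sl(3)]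
        K_expand[OF bracket_in_sl3 sl(1)] K_expand[OF bracket_in_sl3 sl(2)]
        K_expand[OF bracket_in_sl3 sl(3)]
      unfolding U' 1 2 3
      by (simp add: calc algebra_simps) argo
  qed
  have "normal c \<alpha> \<longleftrightarrow>
      bracket (elem_mat 2 3) K12 + bracket (elem_mat 1 3) K1e = 0 \<and>
      bracket (elem_mat 1 3) K2e - bracket (elem_mat 1 2) K12 = 0 \<and>
      K12 + bracket (elem_mat 1 2) K1e + bracket (elem_mat 2 3) K2e = 0" (is "_ \<longleftrightarrow> ?E")
  proof
    show ?E if "normal c \<alpha>"
      using that[unfolded normal_K, rule_format, OF sl(1)] that[unfolded normal_K, rule_format, OF sl(2)]
        that[unfolded normal_K, rule_format, OF sl(3)]
      by (simp add: elem_mat_def eq_neg_iff_add_eq_0 algebra_simps)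
    show "normal c \<alpha>" if E: ?E
      unfolding normal_K
    proof
      fix U :: mat3
      have "K12 = - (bracket (elem_mat 1 2) K1e + bracket (elem_mat 2 3) K2e)"
        using E unfolding eq_neg_iff_add_eq_0 add.assoc by blast
      then have "(U$3$1) *\<^sub>R K12 = - ((U$3$1) *\<^sub>R (bracket (elem_mat 1 2) K1e + bracket (elem_mat 2 3) K2e))"
        by (metis scaleR_minus_right)
      then show "(U$3$1) *\<^sub>R K12 =
        (U$2$1) *\<^sub>R (bracket (elem_mat 2 3) K12 + bracket (elem_mat 1 3) K1e)
        + (U$3$2) *\<^sub>R (bracket (elem_mat 1 3) K2e - bracket (elem_mat 1 2) K12)
        - (U$3$1) *\<^sub>R (bracket (elem_mat 1 2) K1e + bracket (elem_mat 2 3) K2e)"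
        by (simp only: E scaleR_zero_right add_0 diff_0)
    qed
  qed
  also have "\<dots> \<longleftrightarrow> D1 = q \<and> D4 = - r \<and>
      - 2 * A1 - A2 - D2 - 3 * D3 - p = 0 \<and> 2 * A1 + A2 - 3 * D2 - D3 - p = 0 \<and>
      2 * A1 - A2 - D2 + D3 + p = 0 \<and>
      3 * C + D1 * D4 - D2 * D3 + D3 * (- A1 - 2 * A2) + p * D3 + q * D4
        - D2 * (A2 - A1) - r * D1 + p * D2 = 0"
    unfolding K12_def K1e_def K2e_def
    by (simp add: K sl, simp add: calc,
        (intro iffI; elim conjE; intro conjI; (linarith | (erule trans[rotated], simp (no_asm) add: algebra_simps))))
  also have "\<dots> \<longleftrightarrow> ?R"
  proof
    assume R: ?R
    have R': "A2 = p / 2" "C = q * r - A1 * (A1 + p / 2)" "D1 = q" "D2 = A1"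
      "D3 = - (A1 + p / 2)" "D4 = - r"
      using R by blast+
    show "D1 = q \<and> D4 = - r \<and>
      - 2 * A1 - A2 - D2 - 3 * D3 - p = 0 \<and> 2 * A1 + A2 - 3 * D2 - D3 - p = 0 \<and>
      2 * A1 - A2 - D2 + D3 + p = 0 \<and>
      3 * C + D1 * D4 - D2 * D3 + D3 * (- A1 - 2 * A2) + p * D3 + q * D4
        - D2 * (A2 - A1) - r * D1 + p * D2 = 0"
      unfolding R' by (simp add: field_simps)
  next
    assume L: "D1 = q \<and> D4 = - r \<and>
      - 2 * A1 - A2 - D2 - 3 * D3 - p = 0 \<and> 2 * A1 + A2 - 3 * D2 - D3 - p = 0 \<and>
      2 * A1 - A2 - D2 + D3 + p = 0 \<and>
      3 * C + D1 * D4 - D2 * D3 + D3 * (- A1 - 2 * A2) + p * D3 + q * D4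
        - D2 * (A2 - A1) - r * D1 + p * D2 = 0"
    then have lin: "A2 = p / 2" "D2 = A1" "D3 = - (A1 + p / 2)" "D1 = q" "D4 = - r"
      by auto
    have "3 * C + D1 * D4 - D2 * D3 + D3 * (- A1 - 2 * A2) + p * D3 + q * D4
        - D2 * (A2 - A1) - r * D1 + p * D2 = 0"
      using L by blast
    then have "3 * (C - q * r + A1 * (A1 + p / 2)) = 0"
      unfolding lin by (simp add: field_simps)
    then show ?R
      using lin by simp
  qed
  finally show ?thesis .
qed


section \<open>Normal form of the regular normal extensions\<close>

text \<open>
  The matrix \<open>cartan_form\<close> with the solution of the normalization equations inserted; \<open>A\<close> is the
  parameter they leave free, and \<open>A'\<close> makes the trace zero.
\<close>

definition normal_form :: "real \<Rightarrow> real \<Rightarrow> real \<Rightarrow> real \<Rightarrow> real \<Rightarrow> real \<Rightarrow> real \<Rightarrow> mat3" where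
  "normal_form p q r A z y1 y2 =
     (let A' = - (A + p / 2)
      in vector
        [vector [A * z, q * y1 + A * y2, (q * r + A * A') * z],
         vector [y1, p / 2 * z, A' * y1 - r * y2],
         vector [z, y2, A' * z]])"

lemma normal_form_eq_cartan_form:
  "normal_form p q r A =
    cartan_form A (p / 2) (q * r - A * (A + p / 2)) q A (- (A + p / 2)) (- r)"
  by (intro ext) (simp add: normal_form_def cartan_form_def Let_def mat3_of_eq_iff algebra_simps)

text \<open>
  Equivariance under \<open>h\<close> kills the entries of the wrong parity. Bijectivity modulo \<open>\<pp>\<close> makes the matrix of
  \<open>b\<close>-coefficients invertible, so that \<open>E21\<close> and \<open>E32\<close> have lifts to \<open>\<mm>\<close>. The lower left entry of the
  curvature on these lifts is \<open>e31/\<Delta> - 1\<close>, where \<open>e31\<close> is the coefficient of \<open>e\<close> in the lower left entry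
  of \<open>\<alpha>\<close>, and regularity makes it vanish.
\<close>

lemma regular_extension_adapted:
  assumes ext: "extension c \<alpha>" and reg: "regular c \<alpha>"
  obtains b1 b2 b3 b4 A1 A2 C D1 D2 D3 D4
  where "adapted c \<alpha> b1 b2 b3 b4 A1 A2 C D1 D2 D3 D4"
proof -
  obtain e11 e12 e13 e21 e22 e23 e31 e32 e33
    where e: "\<alpha> (so_elt c 1 0 0) = mat3_of e11 e12 e13 e21 e22 e23 e31 e32 e33"
    by (rule mat3_of_cases)
  obtain f11 f12 f13 f21 f22 f23 f31 f32 f33
    where f: "\<alpha> (so_elt c 0 1 0) = mat3_of f11 f12 f13 f21 f22 f23 f31 f32 f33"
    by (rule mat3_of_cases)
  obtain g11 g12 g13 g21 g22 g23 g31 g32 g33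
    where g: "\<alpha> (so_elt c 0 0 1) = mat3_of g11 g12 g13 g21 g22 g23 g31 g32 g33"
    by (rule mat3_of_cases)
  have add: "\<alpha> (X + Y) = \<alpha> X + \<alpha> Y" if "X \<in> so_alg c" "Y \<in> so_alg c" for X Y
    using ext that by (simp add: extension_def)
  have scale: "\<alpha> (k *\<^sub>R X) = k *\<^sub>R \<alpha> X" if "X \<in> so_alg c" for k X
    using ext that by (simp add: extension_def)
  have lin: "\<alpha> (so_elt c x y z) =
      x *\<^sub>R \<alpha> (so_elt c 1 0 0) + y *\<^sub>R \<alpha> (so_elt c 0 1 0) + z *\<^sub>R \<alpha> (so_elt c 0 0 1)" for x y z
    by (simp add: add[symmetric] scale[symmetric] so_elt_add so_elt_scaleR)
  have equi: "\<alpha> (so_elt c x (- y) (- z)) = Ad (iota h_sym) (\<alpha> (so_elt c x y z))" for x y z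
    using ext by (simp add: extension_def K_group_def flip: Ad_h_sym)
  have zero: "e12 = 0" "e21 = 0" "e23 = 0" "e32 = 0"
    "f11 = 0" "f13 = 0" "f22 = 0" "f31 = 0" "f33 = 0"
    "g11 = 0" "g13 = 0" "g22 = 0" "g31 = 0" "g33 = 0"
    using equi[of 1 0 0] equi[of 0 1 0] equi[of 0 0 1] lin[of 0 "-1" 0] lin[of 0 0 "-1"]
    by (simp_all add: e f g Ad_iota_h_sym mat3_of_arith mat3_of_eq_iff)
  have "\<alpha> (so_elt c 1 0 0) \<in> sl3"
    using ext by (simp add: extension_def)
  then have e33: "e33 = - (e11 + e22)"
    by (simp add: e sl3_iff)
  define \<Delta> where "\<Delta> = f21 * g32 - g21 * f32"
  have \<alpha>: "\<alpha> (so_elt c x y z) =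
      mat3_of (e11 * x) (f12 * y + g12 * z) (e13 * x) (f21 * y + g21 * z) (e22 * x) (f23 * y + g23 * z)
        (e31 * x) (f32 * y + g32 * z) (- (e11 + e22) * x)" for x y z
    by (subst lin) (simp add: e f g zero e33 mat3_of_arith mat3_of_eq_iff)
  have \<alpha>0: "\<alpha> (so_elt c 0 0 0) = 0"
    by (simp add: \<alpha> mat3_of_arith)
  have zero_sl: "0 \<in> sl3" "(0::mat3) \<in> p_alg"
    by (simp_all add: sl3_iff p_alg_iff)
  have inj: "x = 0 \<and> y = 0 \<and> z = 0" if "\<alpha> (so_elt c x y z) \<in> p_alg" for x y z
  proof -
    have "\<exists>!X. X \<in> so_alg c \<and> \<alpha> X - 0 \<in> p_alg"
      using ext zero_sl(1) unfolding extension_def by blast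
    then have "so_elt c x y z = so_elt c 0 0 0"
      using that zero_sl(2) \<alpha>0 by (metis diff_zero so_elt_in_so_alg)
    then show ?thesis
      by (simp add: so_elt_eq_iff)
  qed
  have p_alg: "\<alpha> (so_elt c x y z) \<in> p_alg \<longleftrightarrow>
      e31 * x = 0 \<and> f21 * y + g21 * z = 0 \<and> f32 * y + g32 * z = 0" for x y z
    by (auto simp: \<alpha> p_alg_iff sl3_iff algebra_simps)
  have \<Delta>: "\<Delta> \<noteq> 0"
  proof
    assume "\<Delta> = 0"
    then have "\<alpha> (so_elt c 0 g32 (- f32)) \<in> p_alg" "\<alpha> (so_elt c 0 g21 (- f21)) \<in> p_alg"
      by (simp_all add: p_alg \<Delta>_def algebra_simps)
    then have "g32 = 0 \<and> f32 = 0 \<and> g21 = 0 \<and> f21 = 0"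
      using inj by force
    then have "\<alpha> (so_elt c 0 1 0) \<in> p_alg"
      by (simp add: p_alg)
    then show False
      using inj by force
  qed
  have lift: "g_lift c \<alpha> U = so_elt c 0 y z"
    if "U \<in> sl3" "U $ 3 $ 1 = 0" "U $ 2 $ 1 = f21 * y + g21 * z" "U $ 3 $ 2 = f32 * y + g32 * z" for U y z
    unfolding g_lift_def
  proof (rule the1_equality)
    show "\<exists>!X. X \<in> so_alg c \<and> \<alpha> X - U \<in> p_alg"
      using ext \<open>U \<in> sl3\<close> unfolding extension_def by blast
    show "so_elt c 0 y z \<in> so_alg c \<and> \<alpha> (so_elt c 0 y z) - U \<in> p_alg"
      using that by (simp add: \<alpha> p_alg_iff sl3_iff)
  qed
  define u1 u2 w1 w2 where uw: "u1 = g32 / \<Delta>" "u2 = - f32 / \<Delta>" "w1 = - g21 / \<Delta>" "w2 = f21 / \<Delta>"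
  have dual: "f21 * u1 + g21 * u2 = 1" "f21 * w1 + g21 * w2 = 0"
    "f32 * u1 + g32 * u2 = 0" "f32 * w1 + g32 * w2 = 1"
    using \<Delta> by (simp_all add: uw \<Delta>_def mult.commute flip: diff_divide_distrib)
  have comm: "u2 * w1 - u1 * w2 = - (1 / \<Delta>)"
  proof -
    have "u2 * w1 - u1 * w2 = - \<Delta> / (\<Delta> * \<Delta>)"
      by (simp add: uw \<Delta>_def diff_divide_distrib mult.commute)
    then show ?thesis
      using \<Delta> by simp
  qed
  have "g_lift c \<alpha> (elem_mat 2 1) = so_elt c 0 u1 u2" "g_lift c \<alpha> (elem_mat 3 2) = so_elt c 0 w1 w2"
    by (rule lift; simp only: elem_mat_mat3_of sl3_iff vector_3 dual; simp)+
  then have curv: "curvature_lp c \<alpha> (elem_mat 2 1) (elem_mat 3 2) $ 3 $ 1 = e31 / \<Delta> - 1"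
    by (simp only: curvature_lp_def curvature_def bracket_so_elt comm \<alpha> dual)
      (simp add: bracket_def mat3_of_arith)
  have "curvature_lp c \<alpha> (elem_mat 2 1) (elem_mat 3 2) \<in> sl3_filt (- 1)"
  proof -
    have "elem_mat 2 1 \<in> sl3_grade (- 1)" "elem_mat 3 2 \<in> sl3_grade (- 1)"
      by (auto simp: sl3_grade_def sl3_iff elem_mat_def pos_def)
    then show ?thesis
      using reg[unfolded regular_def, rule_format, of "- 1" "- 1"] by simp
  qed
  then have "curvature_lp c \<alpha> (elem_mat 2 1) (elem_mat 3 2) $ 3 $ 1 \<noteq> 0 \<longrightarrow> - 1 \<le> pos 1 - pos 3"
    unfolding sl3_filt_def by blast
  then have "e31 = \<Delta>"
    using \<Delta> by (simp add: curv pos_def)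
  define D1 where "D1 = (f12 * g32 - g12 * f32) / \<Delta>"
  define D2 where "D2 = (g12 * f21 - f12 * g21) / \<Delta>"
  define D3 where "D3 = (f23 * g32 - g23 * f32) / \<Delta>"
  define D4 where "D4 = (g23 * f21 - f23 * g21) / \<Delta>"
  have D: "f12 = D1 * f21 + D2 * f32" "g12 = D1 * g21 + D2 * g32"
    "f23 = D3 * f21 + D4 * f32" "g23 = D3 * g21 + D4 * g32"
    unfolding D1_def D2_def D3_def D4_def using \<Delta>
    by (simp_all add: divide_simps) (simp_all add: \<Delta>_def algebra_simps)
  have "adapted c \<alpha> f21 g21 f32 g32 (e11 / \<Delta>) (e22 / \<Delta>) (e13 / \<Delta>) D1 D2 D3 D4"
    unfolding adapted_so_elt_iff \<Delta>_def[symmetric]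
  proof (intro conjI allI \<Delta>)
    fix x y z
    show "\<alpha> (so_elt c x y z) = cartan_form (e11 / \<Delta>) (e22 / \<Delta>) (e13 / \<Delta>) D1 D2 D3 D4
        (\<Delta> * x) (f21 * y + g21 * z) (f32 * y + g32 * z)"
      unfolding \<alpha> cartan_form_def D \<open>e31 = \<Delta>\<close>
      using \<Delta> by (simp add: mat3_of_eq_iff field_simps)
  qed
  then show thesis
    by (rule that)
qed

definition has_normal_form ::
  "real \<Rightarrow> (mat3 \<Rightarrow> mat3) \<Rightarrow> real \<Rightarrow> real \<Rightarrow> real \<Rightarrow> real \<Rightarrow> real \<Rightarrow> bool" where
  "has_normal_form c \<alpha> b1 b2 b3 b4 A \<longleftrightarrow>
     b1 * b4 - b2 * b3 \<noteq> 0 \<and>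
     (\<forall>e x1 x2. \<alpha> (so_elt c e x1 x2) =
        normal_form (str_p c b1 b2 b3 b4) (str_q c b1 b2 b3 b4) (str_r c b1 b2 b3 b4) A
          ((b1 * b4 - b2 * b3) * e) (b1 * x1 + b2 * x2) (b3 * x1 + b4 * x2))"

lemma has_normal_form_adapted:
  "has_normal_form c \<alpha> b1 b2 b3 b4 A \<longleftrightarrow>
    (let p = str_p c b1 b2 b3 b4; q = str_q c b1 b2 b3 b4; r = str_r c b1 b2 b3 b4
     in adapted c \<alpha> b1 b2 b3 b4 A (p / 2) (q * r - A * (A + p / 2)) q A (- (A + p / 2)) (- r))"
  by (simp add: has_normal_form_def adapted_so_elt_iff normal_form_eq_cartan_form Let_def)

lemma regular_normal_extension_if_normal_form:
  assumes "has_normal_form c \<alpha> b1 b2 b3 b4 A"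
  shows "regular_normal_extension c \<alpha>"
proof -
  note ad = assms[unfolded has_normal_form_adapted Let_def]
  show ?thesis
    unfolding regular_normal_extension_def normal_adapted_iff[OF ad]
    using extension_adapted[OF ad] regular_adapted[OF ad] by simp
qed

lemma normal_form_if_regular_normal_extension:
  assumes "regular_normal_extension c \<alpha>"
  obtains b1 b2 b3 b4 A where "has_normal_form c \<alpha> b1 b2 b3 b4 A"
proof -
  obtain b1 b2 b3 b4 A1 A2 C D1 D2 D3 D4 where ad: "adapted c \<alpha> b1 b2 b3 b4 A1 A2 C D1 D2 D3 D4"
    using assms regular_extension_adapted unfolding regular_normal_extension_def by metis
  have "normal c \<alpha>"
    using assms by (simp add: regular_normal_extension_def)
  then have "has_normal_form c \<alpha> b1 b2 b3 b4 A1"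
    using ad unfolding has_normal_form_adapted Let_def normal_adapted_iff[OF ad] by metis
  then show thesis
    by (rule that)
qed

lemma b_coeffs_normal_form:
  assumes "has_normal_form c \<alpha> b1 b2 b3 b4 A" "b_coeffs c \<alpha> b1' b2' b3' b4'"
  shows "b1' = b1 \<and> b2' = b2 \<and> b3' = b3 \<and> b4' = b4"
proof -
  have "b1 * x1 + b2 * x2 = b1' * x1 + b2' * x2 \<and> b3 * x1 + b4 * x2 = b3' * x1 + b4' * x2" for x1 x2
    using assms by (simp add: has_normal_form_def b_coeffs_def normal_form_def Let_def)
  from this[of 1 0] this[of 0 1] show ?thesis
    by simp
qed

text \<open>
  All components of low homogeneity cancel, and what is left are the two entries of degree 1 evaluated on
  \<open>E\<close> and an element of \<open>\<mm>\<close>. This is the curvature that a three-dimensional Cartan geometry of this type can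
  have at most; it vanishes if \<open>p = 0\<close>, and also if \<open>q = r = 0\<close>.
\<close>

lemma curvature_normal_form:
  fixes c b1 b2 b3 b4 A e x1 x2 h v1 v2 :: real
  assumes "has_normal_form c \<alpha> b1 b2 b3 b4 A"
  defines "p \<equiv> str_p c b1 b2 b3 b4" and "q \<equiv> str_q c b1 b2 b3 b4" and "r \<equiv> str_r c b1 b2 b3 b4"
  shows "curvature \<alpha> (so_elt c e x1 x2) (so_elt c h v1 v2) =
    (let \<Delta> = b1 * b4 - b2 * b3;
         \<phi> = \<Delta> * (b1 * (h * x1 - e * v1) + b2 * (h * x2 - e * v2));
         \<psi> = \<Delta> * (b3 * (h * x1 - e * v1) + b4 * (h * x2 - e * v2))
     in vector
      [vector [0, 3 / 2 * p * q * \<phi>, 0],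
       vector [0, 0, 3 / 2 * p * r * \<psi>],
       vector [0, 0, 0]])"
proof -
  note ad = assms(1)[unfolded has_normal_form_adapted Let_def]
  have nz: "b1 * b4 - b2 * b3 \<noteq> 0"
    using assms(1) by (simp add: has_normal_form_def)
  show ?thesis
    unfolding so_elt_eq_frame[OF nz] curvature_adapted[OF ad] p_def[symmetric] q_def[symmetric] r_def[symmetric]
    by (simp add: Let_def mat3_of_eq_iff field_simps)
qed

section \<open>Bundle maps given by translations\<close>

lemma Ck_on_const: "Ck_on k S (\<lambda>x. w)"
  by (induction k arbitrary: w) (auto simp: frechet_derivative_const)

text \<open>
  The first derivative of a linear map is a constant function of the base point, so the recursion stops
  after one step.
\<close>

lemma smooth_on_linear:
  assumes "linear F"
  shows "smooth_on S F"
proof -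
  have der: "(F has_derivative F) (at x)" for x
    using assms by (rule linear_imp_has_derivative)
  then have "frechet_derivative F (at x) v = F v" for x v
    by (metis frechet_derivative_at)
  moreover have "continuous_on S F"
    using assms by (rule linear_continuous_on_compose[OF continuous_on_id])
  ultimately have "Ck_on k S F" for k
    using der by (cases k) (auto simp: Ck_on_const differentiable_def)
  then show ?thesis
    by (simp add: smooth_on_def)
qed

lemma G_group_mult: "g \<in> G_group c \<Longrightarrow> g' \<in> G_group c \<Longrightarrow> g ** g' \<in> G_group c"
  by (simp add: G_group_def det_mul matrix_transpose_mul) (metis matrix_mul_assoc)

lemma P_group_mult:
  assumes "q \<in> P_group" "q' \<in> P_group"
  shows "q ** q' \<in> P_group"
  using assms by (simp add: P_group_def det_mul) (simp add: pos_def forall_3 matrix_matrix_mult_def sum_3)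

lemma matrix_inv_inverse:
  fixes A :: "real^'n^'n"
  assumes "det A \<noteq> 0"
  shows "A ** matrix_inv A = mat 1" "matrix_inv A ** A = mat 1"
proof -
  have "\<exists>B. A ** B = mat 1 \<and> B ** A = mat 1"
    using assms by (simp add: invertible_det_nz[symmetric] invertible_def)
  then have "A ** matrix_inv A = mat 1 \<and> matrix_inv A ** A = mat 1"
    unfolding matrix_inv_def by (rule someI_ex)
  then show "A ** matrix_inv A = mat 1" "matrix_inv A ** A = mat 1"
    by simp_all
qed

lemma matrix_inv_mult:
  fixes A B :: "real^'n^'n"
  assumes "det A \<noteq> 0" "det B \<noteq> 0"
  shows "matrix_inv (A ** B) = matrix_inv B ** matrix_inv A"
proof (rule matrix_inv_unique)
  have "A ** matrix_inv A = mat 1" "B ** matrix_inv B = mat 1"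
    using assms by (simp_all add: matrix_inv_inverse)
  then show "A ** B ** (matrix_inv B ** matrix_inv A) = mat 1"
    by (metis matrix_mul_assoc matrix_mul_rid)
qed

lemma det_G_P: "g \<in> G_group c \<Longrightarrow> det g \<noteq> 0" "q \<in> P_group \<Longrightarrow> det q \<noteq> 0"
  by (simp_all add: G_group_def P_group_def)

lemma matrix_add_rdistrib:
  fixes A B C :: mat3
  shows "(A + B) ** C = A ** C + B ** C"
  by (simp add: vec_eq_iff matrix_matrix_mult_def sum.distrib algebra_simps)

lemma scaleR_matrix_mult:
  fixes A B :: mat3
  shows "(k *\<^sub>R A) ** B = k *\<^sub>R (A ** B)" "A ** (k *\<^sub>R B) = k *\<^sub>R (A ** B)"
  by (simp_all add: vec_eq_iff matrix_matrix_mult_def sum_distrib_left mult.left_commute mult.assoc)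

text \<open>
  The map \<open>(g, w) \<mapsto> (g r, a w)\<close> of \<open>G \<times> P\<close> descends to the quotient because it commutes with the action
  of \<open>K\<close>. It is linear in the ambient space, hence smooth and its own derivative, so the pulled
  back form can be read off: translating by \<open>r\<close> changes \<open>\<omega>\<^sub>G\<close> by \<open>Ad r\<^sup>-\<^sup>1\<close>, and \<open>a\<close> acts
  by \<open>Ad a\<^sup>-\<^sup>1\<close> on the values.
\<close>

lemma equivalent_ext_by_symmetry:
  fixes r r' a a' :: mat3
  assumes r: "r \<in> G_group c" "r' \<in> G_group c" "r ** r' = mat 1" "r ** h_sym = h_sym ** r"
    and a: "a \<in> P_group" "a' \<in> P_group" "a ** a' = mat 1" "a ** iota h_sym = iota h_sym ** a"
    and \<alpha>': "\<And>X. X \<in> so_alg c \<Longrightarrow> \<alpha>' X = a' ** \<alpha> (r' ** X ** r) ** a"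
  shows "equivalent_ext c \<alpha> \<alpha>'"
proof -
  define F :: "mat3 \<times> mat3 \<Rightarrow> mat3 \<times> mat3" where "F = (\<lambda>(g, q). (g ** r, a ** q))"
  define F' :: "mat3 \<times> mat3 \<Rightarrow> mat3 \<times> mat3" where "F' = (\<lambda>(g, q). (g ** r', a' ** q))"
  define \<Phi> where "\<Phi> = (\<lambda>S. F ` S)"
  have left_inv: "r' ** r = mat 1" "a' ** a = mat 1"
    using r(3) a(3) matrix_left_right_inverse by blast+
  have F_F': "F (F' u) = u" and F'_F: "F' (F u) = u" for u
    by (auto simp: F_def F'_def split_beta r(3) a(3) left_inv simp flip: matrix_mul_assoc)
       (simp_all add: matrix_mul_assoc r(3) a(3) left_inv)
  have total: "F u \<in> total_space c" "F' u \<in> total_space c" if "u \<in> total_space c" for u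
    using that r a by (auto simp: total_space_def F_def F'_def intro: G_group_mult P_group_mult)
  have orbit_F: "orbit (F u) = \<Phi> (orbit u)" for u
  proof -
    have k: "r ** k = k ** r" "matrix_inv (iota k) ** a = a ** matrix_inv (iota k)" if "k \<in> K_group" for k
    proof -
      have "k = mat 1 \<or> k = h_sym"
        using that by (simp add: K_group_def)
      then have "matrix_inv (iota k) = iota k"
        using h_sym_involution(2) by (auto simp: iota_one intro!: matrix_inv_unique)
      then show "r ** k = k ** r" "matrix_inv (iota k) ** a = a ** matrix_inv (iota k)"
        using \<open>k = mat 1 \<or> k = h_sym\<close> r(4) a(4) by (auto simp: iota_one)
    qed
    obtain g q where u: "u = (g, q)"
      by (cases u)
    have F_k: "(g ** r ** k, matrix_inv (iota k) ** (a ** q)) = F (g ** k, matrix_inv (iota k) ** q)"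
      if "k \<in> K_group" for k
      using k[OF that] by (metis (mono_tags, lifting) F_def case_prod_conv matrix_mul_assoc)
    have "orbit (F u) = (\<lambda>k. (g ** r ** k, matrix_inv (iota k) ** (a ** q))) ` K_group"
      by (auto simp: u F_def orbit_def)
    also have "\<dots> = (\<lambda>k. F (g ** k, matrix_inv (iota k) ** q)) ` K_group"
      by (rule image_cong[OF refl F_k])
    also have "\<dots> = \<Phi> (orbit u)"
      by (auto simp: u \<Phi>_def orbit_def)
    finally show ?thesis .
  qed
  have "linear F"
  proof (rule linearI)
    show "F (x + y) = F x + F y" for x y
      by (simp add: F_def split_beta matrix_add_ldistrib matrix_add_rdistrib)
    show "F (k *\<^sub>R x) = k *\<^sub>R F x" for k x
      by (simp add: F_def split_beta scaleR_matrix_mult)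
  qed
  have lift: "local_lift c \<Phi> UNIV F"
    unfolding local_lift_def using total orbit_F smooth_on_linear[OF \<open>linear F\<close>] by simp
  have "principal_bundle_iso c \<Phi>"
    unfolding principal_bundle_iso_def
  proof (intro conjI ballI)
    show "bij_betw \<Phi> (assoc_bundle c) (assoc_bundle c)"
    proof (rule bij_betwI')
      show "\<Phi> S = \<Phi> S' \<longleftrightarrow> S = S'" for S S'
        unfolding \<Phi>_def using F'_F by (metis inj_image_eq_iff injI)
      show "\<Phi> S \<in> assoc_bundle c" if "S \<in> assoc_bundle c" for S
        using that total(1) orbit_F unfolding assoc_bundle_def by (metis (no_types, lifting) image_iff)
      show "\<exists>S'\<in>assoc_bundle c. S = \<Phi> S'" if "S \<in> assoc_bundle c" for S
        using that total(2) orbit_F F_F' unfolding assoc_bundle_def by (metis (no_types, lifting) image_iff)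
    qed
    show "\<Phi> (right_act S q) = right_act (\<Phi> S) q" for S q
      by (auto simp: \<Phi>_def right_act_def F_def image_image split_beta matrix_mul_assoc)
    show "\<exists>W F. u \<in> W \<and> local_lift c \<Phi> W F" for u
      using lift by blast
  qed
  moreover have "pulls_back c \<Phi> \<alpha> \<alpha>'"
    unfolding pulls_back_def
  proof (intro ballI)
    fix u assume u: "u \<in> total_space c"
    have "omega \<alpha> (F u) (frechet_derivative F (at u) v) = omega \<alpha>' u v" if tan: "v \<in> tangent c u" for v
    proof -
      obtain g q where gq: "u = (g, q)" "g \<in> G_group c" "q \<in> P_group"
        using u by (auto simp: total_space_def)
      obtain X Y where v: "v = (g ** X, q ** Y)" "X \<in> so_alg c"
        using tan by (auto simp: tangent_def gq)
      have "frechet_derivative F (at u) v = F v"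
        using frechet_derivative_at[OF linear_imp_has_derivative[OF \<open>linear F\<close>]] by metis
      moreover have "matrix_inv (g ** r) = r' ** matrix_inv g"
        using det_G_P(1)[OF gq(2)] det_G_P(1)[OF r(1)] by (simp add: matrix_inv_mult matrix_inv_unique[OF r(3)])
      moreover have inv_aq: "matrix_inv (a ** q) = matrix_inv q ** a'"
        using det_G_P(2)[OF gq(3)] det_G_P(2)[OF a(1)] by (simp add: matrix_inv_mult matrix_inv_unique[OF a(3)])
      moreover have inv_g: "matrix_inv g ** g = mat 1"
        and inv_q: "q ** matrix_inv q = mat 1" "matrix_inv q ** q = mat 1"
        using det_G_P(1)[OF gq(2)] det_G_P(2)[OF gq(3)] by (simp_all add: matrix_inv_inverse)
      moreover have "r' ** matrix_inv g ** (g ** X ** r) = r' ** X ** r"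
        by (metis inv_g matrix_mul_assoc matrix_mul_lid)
      moreover have "matrix_inv q ** a' ** (a ** (q ** Y)) = Y"
        by (metis inv_q(2) left_inv(2) matrix_mul_assoc matrix_mul_lid)
      moreover have "matrix_inv q ** (q ** Y) = Y" "matrix_inv g ** (g ** X) = X"
        by (simp_all add: matrix_mul_assoc inv_q inv_g)
      moreover have "matrix_inv (matrix_inv q) = q"
        by (rule matrix_inv_unique[OF inv_q(2)])
      moreover have "matrix_inv (matrix_inv q ** a') = a ** q"
      proof (rule matrix_inv_unique)
        show "matrix_inv q ** a' ** (a ** q) = mat 1"
          by (metis inv_q(2) left_inv(2) matrix_mul_assoc matrix_mul_lid)
      qed
      ultimately show ?thesis
        using \<alpha>'[OF v(2)] by (simp add: omega_def F_def gq(1) v(1) Ad_def matrix_mul_assoc)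
    qed
    then show "\<exists>W F. u \<in> W \<and> local_lift c \<Phi> W F \<and>
        (\<forall>v\<in>tangent c u. omega \<alpha> (F u) (frechet_derivative F (at u) v) = omega \<alpha>' u v)"
      using lift by blast
  qed
  ultimately show ?thesis
    unfolding equivalent_ext_def by blast
qed

text \<open>
  Conjugation by \<open>a\<close> keeps the normal form: the diagonal rescales the coordinates and the structure constants
  according to their degrees, and the corner entry translates \<open>A\<close>. Writing the conjugation as
  \<open>N a = a N'\<close> keeps the identity polynomial.
\<close>

lemma normal_form_conj:
  fixes k l m s P Q R A z y1 y2 :: real
  defines "a \<equiv> mat3_of (l * m * k) 0 (s * k) 0 (m * k) 0 0 0 k"
  shows "normal_form (l * m * P) (l^2 * Q) (m^2 * R) (l * m * A + s) z y1 y2 ** a =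
    a ** normal_form P Q R A (l * m * z) (l * y1) (m * y2)"
  unfolding a_def normal_form_def Let_def mat3_of_arith mat3_of_eq_iff
  by (simp add: algebra_simps power2_eq_square)

text \<open>
  A regular normal extension is determined up to equivalence by its rows \<open>(b1, b2)\<close> and \<open>(b3, b4)\<close>, and
  these may be changed by an isometry of \<open>diag(1, c)\<close>, given by \<open>u\<close>, \<open>v\<close> and the sign \<open>s\<close>, and by independent
  factors \<open>l\<close> and \<open>m\<close>. The parameters \<open>A\<close> and \<open>A'\<close> are arbitrary, because the corner entry of \<open>a\<close>
  can make up any difference.
\<close>

lemma equivalent_ext_normal_forms:
  fixes c u v s l m :: real
  assumes \<alpha>: "has_normal_form c \<alpha> b1 b2 b3 b4 A" and \<beta>: "has_normal_form c \<beta> b1' b2' b3' b4' A'"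
    and c: "c * c = 1" and uv: "u * u + c * (v * v) = 1" and s: "s * s = 1" and lm: "l \<noteq> 0" "m \<noteq> 0"
    and b': "b1' = l * s * (b1 * u + b2 * v)" "b2' = l * (b2 * u - c * b1 * v)"
      "b3' = m * s * (b3 * u + b4 * v)" "b4' = m * (b4 * u - c * b3 * v)"
  shows "equivalent_ext c \<alpha> \<beta>"
proof -
  define \<Delta> where "\<Delta> = b1 * b4 - b2 * b3"
  define \<Delta>' where "\<Delta>' = b1' * b4' - b2' * b3'"
  have \<Delta>: "\<Delta> \<noteq> 0"
    using \<alpha> by (simp add: has_normal_form_def \<Delta>_def)
  have \<Delta>': "\<Delta>' = l * m * s * \<Delta>"
    using uv unfolding \<Delta>'_def \<Delta>_def b' by algebra
  have pairing: "c * b1' * b3' + b2' * b4' = l * m * (c * b1 * b3 + b2 * b4)"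
    "c * b3'^2 + b4'^2 = m^2 * (c * b3^2 + b4^2)" "c * b1'^2 + b2'^2 = l^2 * (c * b1^2 + b2^2)"
    using c uv s unfolding b' by algebra+
  have \<Delta>'2: "\<Delta>'^2 = l^2 * m^2 * \<Delta>^2"
    using s unfolding \<Delta>' by algebra
  have str: "str_p c b1 b2 b3 b4 = l * m * str_p c b1' b2' b3' b4'"
    "str_q c b1 b2 b3 b4 = l^2 * str_q c b1' b2' b3' b4'"
    "str_r c b1 b2 b3 b4 = m^2 * str_r c b1' b2' b3' b4'"
    unfolding str_p_def str_q_def str_r_def pairing \<Delta>_def[symmetric] \<Delta>'_def[symmetric] \<Delta>'2
    using lm \<Delta> by (simp_all add: divide_simps) algebra+
  \<comment> \<open>The diagonal of \<open>a\<close> has to be proportional to \<open>(l m, m, 1)\<close>; the factor \<open>k\<close> makes its determinant 1.\<close>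
  define k where "k = root 3 (1 / (l * m^2))"
  have k: "l * m^2 * k^3 = 1"
    using lm by (simp add: k_def odd_real_root_pow)
  then have k0: "k \<noteq> 0"
    by auto
  \<comment> \<open>The translation that carries the rescaled parameter of \<open>\<beta>\<close> to the parameter of \<open>\<alpha>\<close>.\<close>
  define t where "t = A - l * m * A'"
  define a :: mat3 where "a = mat3_of (l * m * k) 0 (t * k) 0 (m * k) 0 0 0 k"
  define a' :: mat3 where
    "a' = mat3_of (1 / (l * m * k)) 0 (- t / (l * m * k)) 0 (1 / (m * k)) 0 0 0 (1 / k)"
  define r :: mat3 where "r = mat3_of u v 0 (- c * s * v) (s * u) 0 0 0 s"
  define r' :: mat3 where "r' = mat3_of u (- s * v) 0 (c * v) (s * u) 0 0 0 s"
  have inv_a: "a ** a' = mat 1"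
    using lm k0 by (simp add: a_def a'_def mat3_of_arith mat3_of_eq_iff)
  then have left_inv: "a' ** a = mat 1"
    using matrix_left_right_inverse by blast
  have inv_r: "r ** r' = mat 1"
    unfolding r_def r'_def mat3_of_arith mat3_of_eq_iff
    by (intro conjI; (use c s uv in \<open>algebra | simp\<close>))
  have det_a: "det a = 1" "det a' = 1"
  proof -
    show "det a = 1"
      using k by (simp add: a_def det_3 power2_eq_square power3_eq_cube algebra_simps)
    then show "det a' = 1"
      using inv_a det_mul[of a a'] by simp
  qed
  show ?thesis
  proof (rule equivalent_ext_by_symmetry)
    show "r \<in> G_group c" "r' \<in> G_group c"
      unfolding G_group_def mem_Collect_eq form_matrix_def r_def r'_def mat3_of_arith mat3_of_eq_iff
        det_3 vector_3
      by (intro conjI; (use c s uv in \<open>algebra | simp\<close>))+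
    show "a \<in> P_group" "a' \<in> P_group"
      using det_a by (simp_all add: P_group_def forall_3 pos_def, simp_all add: a_def a'_def)
    show "r ** h_sym = h_sym ** r" "a ** iota h_sym = iota h_sym ** a"
      unfolding iota_h_sym by (simp_all add: r_def a_def h_sym_mat3_of mat3_of_arith mat3_of_eq_iff)
    show "r ** r' = mat 1" "a ** a' = mat 1"
      by (fact inv_r inv_a)+
    fix X assume "X \<in> so_alg c"
    then obtain e x1 x2 where X: "X = so_elt c e x1 x2"
      by (auto simp: so_alg_def)
    have rX: "r' ** X ** r = so_elt c (s * e) (s * u * x1 - c * v * x2) (s * v * x1 + u * x2)"
      unfolding X r_def r'_def so_elt_def mat3_of_arith mat3_of_eq_iff
      by (intro conjI; (use c s uv in \<open>algebra | simp\<close>))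
    have y: "b1' * x1 + b2' * x2 = l * (b1 * (s * u * x1 - c * v * x2) + b2 * (s * v * x1 + u * x2))"
      "b3' * x1 + b4' * x2 = m * (b3 * (s * u * x1 - c * v * x2) + b4 * (s * v * x1 + u * x2))"
      "\<Delta>' * e = l * m * (\<Delta> * (s * e))"
      unfolding b' \<Delta>' by algebra+
    have "\<alpha> (r' ** X ** r) = normal_form (str_p c b1 b2 b3 b4) (str_q c b1 b2 b3 b4) (str_r c b1 b2 b3 b4)
        (l * m * A' + t) (\<Delta> * (s * e)) (b1 * (s * u * x1 - c * v * x2) + b2 * (s * v * x1 + u * x2))
        (b3 * (s * u * x1 - c * v * x2) + b4 * (s * v * x1 + u * x2))"
      using \<alpha> unfolding rX has_normal_form_def \<Delta>_def[symmetric] by (simp add: t_def)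
    moreover have "\<beta> X = normal_form (str_p c b1' b2' b3' b4') (str_q c b1' b2' b3' b4')
        (str_r c b1' b2' b3' b4') A' (\<Delta>' * e) (b1' * x1 + b2' * x2) (b3' * x1 + b4' * x2)"
      using \<beta> unfolding X has_normal_form_def \<Delta>'_def[symmetric] by simp
    ultimately have "\<alpha> (r' ** X ** r) ** a = a ** \<beta> X"
      unfolding y str a_def by (simp only: normal_form_conj)
    then show "\<beta> X = a' ** \<alpha> (r' ** X ** r) ** a"
      by (metis left_inv matrix_mul_assoc matrix_mul_lid)
  qed
qed


section \<open>Reduction to the representatives\<close>

text \<open>
  Rotate (for \<open>c = 1\<close>) or boost (for \<open>c = -1\<close>) the first row to \<open>(n, 0)\<close> with \<open>n\<close> its norm. The second row
  becomes \<open>(m', \<Delta>/n)\<close> for some \<open>m'\<close>, and rescaling yields \<open>(1, 0)\<close> and \<open>(t, 1)\<close>; the sign of \<open>t\<close> is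
  changed by a reflection.
\<close>

lemma equivalent_ext_first_row_anisotropic:
  fixes c b1 b2 b3 b4 A :: real
  assumes \<alpha>: "has_normal_form c \<alpha> b1 b2 b3 b4 A" and c: "c * c = 1" and pos: "0 < b1^2 + c * b2^2"
    and \<beta>: "\<And>t. has_normal_form c (\<beta> t) 1 0 t 1 (A' t)"
  shows "\<exists>t\<ge>0. equivalent_ext c \<alpha> (\<beta> t)"
proof -
  define n where "n = sqrt (b1^2 + c * b2^2)"
  have n: "n > 0" "n * n = b1^2 + c * b2^2"
    using pos by (simp_all add: n_def)
  define \<Delta> where "\<Delta> = b1 * b4 - b2 * b3"
  have \<Delta>: "\<Delta> \<noteq> 0"
    using \<alpha> by (simp add: has_normal_form_def \<Delta>_def)
  define u where "u = b1 / n"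
  define v where "v = c * b2 / n"
  have un: "u * n = b1" and vn: "v * n = c * b2"
    using n by (simp_all add: u_def v_def)
  have uv: "u * u + c * (v * v) = 1"
  proof -
    have "n * n * (u * u + c * (v * v)) = (u * n)^2 + c * (v * n)^2"
      by algebra
    also have "\<dots> = n * n"
      unfolding un vn n(2) using c by algebra
    finally show ?thesis
      using n(1) by simp
  qed
  have b: "b1 * u + b2 * v = n" "b2 * u - c * b1 * v = 0" "n * (b4 * u - c * b3 * v) = \<Delta>"
  proof -
    have "n * (b1 * u + b2 * v) = b1 * (u * n) + b2 * (v * n)"
      "n * (b2 * u - c * b1 * v) = b2 * (u * n) - c * b1 * (v * n)"
      "n * (b4 * u - c * b3 * v) = b4 * (u * n) - c * b3 * (v * n)"
      by algebra+
    moreover have "b1 * b1 + b2 * (c * b2) = n * n" "b2 * b1 - c * b1 * (c * b2) = n * 0"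
      "b4 * b1 - c * b3 * (c * b2) = \<Delta>"
      using c unfolding \<Delta>_def n(2) by (algebra | simp add: algebra_simps power2_eq_square)+
    ultimately have "n * (b1 * u + b2 * v) = n * n" "n * (b2 * u - c * b1 * v) = n * 0"
      "n * (b4 * u - c * b3 * v) = \<Delta>"
      by (simp_all only: un vn)
    then show "b1 * u + b2 * v = n" "b2 * u - c * b1 * v = 0" "n * (b4 * u - c * b3 * v) = \<Delta>"
      using n(1) by auto
  qed
  define m where "m = n / \<Delta>"
  define w where "w = m * (b3 * u + b4 * v)"
  define s :: real where "s = (if w \<ge> 0 then 1 else - 1)"
  have s: "s * s = 1" "s * w = \<bar>w\<bar>" "s \<noteq> 0"
    by (auto simp: s_def)
  have "equivalent_ext c \<alpha> (\<beta> \<bar>w\<bar>)"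
  proof (rule equivalent_ext_normal_forms[OF \<alpha> \<beta> c uv s(1), of "s / n" m])
    show "s / n \<noteq> 0" "m \<noteq> 0"
      using s n \<Delta> by (simp_all add: m_def)
    show "1 = s / n * s * (b1 * u + b2 * v)" "0 = s / n * (b2 * u - c * b1 * v)"
      using n(1) s(1) by (simp_all add: b)
    show "\<bar>w\<bar> = m * s * (b3 * u + b4 * v)"
      using s(2) by (simp add: w_def mult_ac)
    show "1 = m * (b4 * u - c * b3 * v)"
      using b(3) \<Delta> by (simp add: m_def)
  qed
  then show ?thesis
    by (intro exI[of _ "\<bar>w\<bar>"]) simp
qed

text \<open>
  A boost carries the second row, whose norm is negative, to \<open>(0, n)\<close>. The first row stays
  isotropic, and a reflection and rescaling make it \<open>(1, 1)\<close>.
\<close>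

lemma equivalent_ext_first_row_isotropic:
  fixes b1 b2 b3 b4 A :: real
  assumes \<alpha>: "has_normal_form (- 1) \<alpha> b1 b2 b3 b4 A" and iso: "b1^2 = b2^2" and pos: "b3^2 < b4^2"
    and \<beta>: "has_normal_form (- 1) \<beta> 1 1 0 1 A'"
  shows "equivalent_ext (- 1) \<alpha> \<beta>"
proof -
  define n where "n = sqrt (b4^2 - b3^2)"
  have n: "n > 0" "n * n = b4^2 - b3^2"
    using pos by (simp_all add: n_def)
  define u where "u = b4 / n"
  define v where "v = - b3 / n"
  have un: "u * n = b4" and vn: "v * n = - b3"
    using n by (simp_all add: u_def v_def)
  have uv: "u * u + - 1 * (v * v) = 1"
  proof -
    have "n * n * (u * u + - 1 * (v * v)) = (u * n)^2 - (v * n)^2"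
      by algebra
    also have "\<dots> = n * n"
      unfolding un vn n(2) by simp
    finally show ?thesis
      using n(1) by simp
  qed
  have b: "b3 * u + b4 * v = 0" "b4 * u - - 1 * b3 * v = n"
  proof -
    have "n * (b3 * u + b4 * v) = b3 * (u * n) + b4 * (v * n)"
      "n * (b4 * u - - 1 * b3 * v) = b4 * (u * n) + b3 * (v * n)"
      by algebra+
    then have "n * (b3 * u + b4 * v) = n * 0" "n * (b4 * u - - 1 * b3 * v) = n * n"
      unfolding un vn n(2) by (simp_all add: power2_eq_square)
    then show "b3 * u + b4 * v = 0" "b4 * u - - 1 * b3 * v = n"
      using n(1) by auto
  qed
  obtain s where s: "s * s = 1" "b2 = s * b1"
  proof -
    have "b2 = b1 \<or> b2 = - b1"
      using iso by (auto simp: power2_eq_iff)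
    then show thesis
      using that[of 1] that[of "- 1"] by auto
  qed
  define w where "w = b1 * (u + s * v)"
  \<comment> \<open>proof
The factor by which the boost stretches an isotropic row cannot vanish.\<close>
  have "w \<noteq> 0"
  proof
    assume "w = 0"
    moreover have "b1 \<noteq> 0"
      using \<alpha> s by (auto simp: has_normal_form_def)
    ultimately have "u + s * v = 0"
      by (simp add: w_def)
    then have "u * u - v * v = 0"
      using s(1) by algebra
    then show False
      using uv by simp
  qed
  have b12: "s * (b1 * u + b2 * v) = s * w" "b2 * u - - 1 * b1 * v = s * w"
    using s(1) unfolding w_def s(2) by (algebra | simp add: algebra_simps)+
  show ?thesis
  proof (rule equivalent_ext_normal_forms[OF \<alpha> \<beta> _ uv s(1), of "s / w" "1 / n"])
    show "s / w \<noteq> 0" "1 / n \<noteq> 0"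
      using s(1) n(1) \<open>w \<noteq> 0\<close> by auto
    show "1 = s / w * s * (b1 * u + b2 * v)" "1 = s / w * (b2 * u - - 1 * b1 * v)"
      unfolding mult.assoc[of "s / w" s] b12 using \<open>w \<noteq> 0\<close> s(1) by simp_all
    show "0 = 1 / n * s * (b3 * u + b4 * v)" "1 = 1 / n * (b4 * u - - 1 * b3 * v)"
      unfolding b using n(1) by simp_all
  qed simp
qed

text \<open>
  Linearly independent isotropic rows lie on different isotropic lines, so a reflection and rescaling
  already suffice.
\<close>

lemma equivalent_ext_both_rows_isotropic:
  fixes b1 b2 b3 b4 A :: real
  assumes \<alpha>: "has_normal_form (- 1) \<alpha> b1 b2 b3 b4 A" and iso: "b1^2 = b2^2" "b3^2 = b4^2"
    and \<beta>: "has_normal_form (- 1) \<beta> 1 1 (- 1) 1 A'"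
  shows "equivalent_ext (- 1) \<alpha> \<beta>"
proof -
  have nz: "b1 * b4 - b2 * b3 \<noteq> 0"
    using \<alpha> by (simp add: has_normal_form_def)
  have signs: "b2 = b1 \<or> b2 = - b1" "b3 = b4 \<or> b3 = - b4"
    using iso by (auto simp: power2_eq_iff)
  have b0: "b1 \<noteq> 0" "b4 \<noteq> 0"
    using nz signs by auto
  have "b2 = b1 \<and> b3 = - b4 \<or> b2 = - b1 \<and> b3 = b4"
    using nz signs by auto
  then obtain s where s: "s * s = 1" "b2 = s * b1" "b3 = - s * b4"
    by (elim disjE) (use that[of 1] that[of "- 1"] in simp_all)
  show ?thesis
  proof (rule equivalent_ext_normal_forms[OF \<alpha> \<beta> _ _ s(1), of 1 0 "s / b1" "1 / b4"])
    show "s / b1 \<noteq> 0" "1 / b4 \<noteq> 0"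
      using s(1) b0 by auto
    show "1 = s / b1 * s * (b1 * 1 + b2 * 0)" "1 = s / b1 * (b2 * 1 - - 1 * b1 * 0)"
      "- 1 = 1 / b4 * s * (b3 * 1 + b4 * 0)" "1 = 1 / b4 * (b4 * 1 - - 1 * b3 * 0)"
      using s b0 by (simp_all add: field_simps)
  qed simp_all
qed


section \<open>The four families\<close>

lemmas normal_form_simps = has_normal_form_def normal_form_def so_elt_def Let_def str_p_def str_q_def
  str_r_def mat3_of_eq_iff in_coords_def

lemma alpha_I_normal_form: "has_normal_form 1 (alpha_I t) 1 0 t 1 (t / 4)"
  by (simp add: normal_form_simps alpha_I_def field_simps power2_eq_square)

lemma alpha_IIa_normal_form: "has_normal_form (- 1) (alpha_IIa t) 1 0 t 1 (- t / 4)"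
  by (simp add: normal_form_simps alpha_IIa_def field_simps power2_eq_square)

lemma alpha_IIb_normal_form: "has_normal_form (- 1) alpha_IIb 1 1 0 1 (1 / 4)"
  by (simp add: normal_form_simps alpha_IIb_def field_simps)

lemma alpha_IIc_normal_form: "has_normal_form (- 1) alpha_IIc 1 1 (- 1) 1 (1 / 8)"
  by (simp add: normal_form_simps alpha_IIc_def field_simps)

lemma curvature_alpha_I:
  "curvature (alpha_I t) (so_elt 1 e x1 x2) (so_elt 1 h y1 y2) = vector
     [vector [0, 3 * (t^3 + t) / 2 * (h * x1 - e * y1), 0],
      vector [0, 0, - (3 * t^2 / 2) * (h * x1 - e * y1) - 3 * t / 2 * (h * x2 - e * y2)],
      vector [0, 0, 0]]"
  unfolding curvature_normal_form[OF alpha_I_normal_form]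
  by (simp add: Let_def str_p_def str_q_def str_r_def mat3_of_eq_iff field_simps power2_eq_square
      power3_eq_cube)

lemma curvature_alpha_IIa:
  "curvature (alpha_IIa t) (so_elt (- 1) e x1 x2) (so_elt (- 1) h y1 y2) = vector
     [vector [0, 3 * (t^3 - t) / 2 * (h * x1 - e * y1), 0],
      vector [0, 0, - (3 * t^2 / 2) * (h * x1 - e * y1) - 3 * t / 2 * (h * x2 - e * y2)],
      vector [0, 0, 0]]"
  unfolding curvature_normal_form[OF alpha_IIa_normal_form]
  by (simp add: Let_def str_p_def str_q_def str_r_def mat3_of_eq_iff field_simps power2_eq_square
      power3_eq_cube)

lemma curvature_alpha_IIb:
  "curvature alpha_IIb (so_elt (- 1) e x1 x2) (so_elt (- 1) h y1 y2) = vector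
     [vector [0, 3 / 2 * (h * x1 - e * y1) + 3 / 2 * (h * x2 - e * y2), 0],
      vector [0, 0, 0],
      vector [0, 0, 0]]"
  unfolding curvature_normal_form[OF alpha_IIb_normal_form]
  by (simp add: Let_def str_p_def str_q_def str_r_def mat3_of_eq_iff field_simps)

lemma flat_alpha_IIc: "flat (- 1) alpha_IIc"
  unfolding flat_def so_alg_def
  by (auto simp: curvature_normal_form[OF alpha_IIc_normal_form] Let_def str_p_def str_q_def str_r_def
      mat3_of_eq_iff mat3_of_arith)


theorem theorem4p2:
  shows
    "\<comment> \<open>I: so(3)/so(2)\<close>
     (\<forall>t\<ge>0.
        regular_normal_extension 1 (alpha_I t) \<and>
        (\<forall>e x1 x2 h y1 y2.
           curvature (alpha_I t) (so_elt 1 e x1 x2) (so_elt 1 h y1 y2) = vector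
             [vector [0, 3 * (t^3 + t) / 2 * (h * x1 - e * y1), 0],
              vector [0, 0, - (3 * t^2 / 2) * (h * x1 - e * y1) - 3 * t / 2 * (h * x2 - e * y2)],
              vector [0, 0, 0]])) \<and>
     (\<forall>\<alpha>. regular_normal_extension 1 \<alpha> \<longrightarrow> (\<exists>t\<ge>0. equivalent_ext 1 \<alpha> (alpha_I t))) \<and>
     \<comment> \<open>II: so(2,1)/so(1,1)\<close>
     (\<forall>t\<ge>0.
        regular_normal_extension (- 1) (alpha_IIa t) \<and>
        (\<forall>e x1 x2 h y1 y2.
           curvature (alpha_IIa t) (so_elt (- 1) e x1 x2) (so_elt (- 1) h y1 y2) = vector
             [vector [0, 3 * (t^3 - t) / 2 * (h * x1 - e * y1), 0],
              vector [0, 0, - (3 * t^2 / 2) * (h * x1 - e * y1) - 3 * t / 2 * (h * x2 - e * y2)],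
              vector [0, 0, 0]])) \<and>
     regular_normal_extension (- 1) alpha_IIb \<and>
     (\<forall>e x1 x2 h y1 y2.
        curvature alpha_IIb (so_elt (- 1) e x1 x2) (so_elt (- 1) h y1 y2) = vector
          [vector [0, 3 / 2 * (h * x1 - e * y1) + 3 / 2 * (h * x2 - e * y2), 0],
           vector [0, 0, 0],
           vector [0, 0, 0]]) \<and>
     regular_normal_extension (- 1) alpha_IIc \<and>
     flat (- 1) alpha_IIc \<and>
     (\<forall>\<alpha> b1 b2 b3 b4.
        regular_normal_extension (- 1) \<alpha> \<and> b_coeffs (- 1) \<alpha> b1 b2 b3 b4 \<longrightarrow>
          (b1^2 > b2^2 \<longrightarrow> (\<exists>t\<ge>0. equivalent_ext (- 1) \<alpha> (alpha_IIa t))) \<and>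
          (b1^2 = b2^2 \<and> b3^2 < b4^2 \<longrightarrow> equivalent_ext (- 1) \<alpha> alpha_IIb) \<and>
          (b1^2 = b2^2 \<and> b3^2 = b4^2 \<longrightarrow> equivalent_ext (- 1) \<alpha> alpha_IIc))"
proof (intro conjI allI impI)
  fix t :: real
  show "regular_normal_extension 1 (alpha_I t)"
    by (rule regular_normal_extension_if_normal_form[OF alpha_I_normal_form])
  show "regular_normal_extension (- 1) (alpha_IIa t)"
    by (rule regular_normal_extension_if_normal_form[OF alpha_IIa_normal_form])
next
  fix \<alpha> assume "regular_normal_extension 1 \<alpha>"
  then obtain b1 b2 b3 b4 A where \<alpha>: "has_normal_form 1 \<alpha> b1 b2 b3 b4 A"
    by (rule normal_form_if_regular_normal_extension)
  then have "0 < b1^2 + 1 * b2^2"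
    by (auto simp: has_normal_form_def sum_power2_gt_zero_iff)
  then show "\<exists>t\<ge>0. equivalent_ext 1 \<alpha> (alpha_I t)"
    using equivalent_ext_first_row_anisotropic[OF \<alpha> _ _ alpha_I_normal_form] by simp
next
  show "regular_normal_extension (- 1) alpha_IIb"
    by (rule regular_normal_extension_if_normal_form[OF alpha_IIb_normal_form])
  show "regular_normal_extension (- 1) alpha_IIc"
    by (rule regular_normal_extension_if_normal_form[OF alpha_IIc_normal_form])
next
  fix \<alpha> b1 b2 b3 b4
  assume "regular_normal_extension (- 1) \<alpha> \<and> b_coeffs (- 1) \<alpha> b1 b2 b3 b4"
  then obtain A where \<alpha>: "has_normal_form (- 1) \<alpha> b1 b2 b3 b4 A"
    by (metis normal_form_if_regular_normal_extension b_coeffs_normal_form)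
  show "\<exists>t\<ge>0. equivalent_ext (- 1) \<alpha> (alpha_IIa t)" if "b1^2 > b2^2"
    using equivalent_ext_first_row_anisotropic[OF \<alpha> _ _ alpha_IIa_normal_form] that by simp
  show "equivalent_ext (- 1) \<alpha> alpha_IIb" if "b1^2 = b2^2 \<and> b3^2 < b4^2"
    using equivalent_ext_first_row_isotropic[OF \<alpha> _ _ alpha_IIb_normal_form] that by simp
  show "equivalent_ext (- 1) \<alpha> alpha_IIc" if "b1^2 = b2^2 \<and> b3^2 = b4^2"
    using equivalent_ext_both_rows_isotropic[OF \<alpha> _ _ alpha_IIc_normal_form] that by simp
qed (rule curvature_alpha_I curvature_alpha_IIa curvature_alpha_IIb flat_alpha_IIc)+

end
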